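(* For every $\tau\in\mathbb{H}^2$, $$\frac{\theta'[\frac13,\frac13]}{\theta[\frac13,\frac13]}=\frac13\,\frac{\theta'[1,1]\,\theta^3[\frac13,\frac13]}{\theta[0,1]\,\theta^3[\frac23,\frac53]}-\zeta_3\,\frac{\theta'[1,1]\,\theta[0,1]\,\theta[\frac13,\frac43]\,\theta[\frac23,\frac23]}{\theta[0,0]\,\theta[1,0]\,\theta[\frac13,\frac13]\,\theta[\frac23,\frac53]}$$ $$=-\frac{\pi}{3}\,\theta[0,0]\,\theta[1,0]\,\frac{\theta^3[\frac13,\frac13]}{\theta^3[\frac23,\frac53]}+\pi\zeta_3\,\theta^2[0,1]\,\frac{\theta[\frac13,\frac43]\,\theta[\frac23,\frac23]}{\theta[\frac13,\frac13]\,\theta[\frac23,\frac53]}.$$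
   Context: $\mathbb{H}^2=\{\tau\in\mathbb{C} : \Im\tau>0\}$ is the upper half plane and $\zeta_k=\exp(2\pi i/k)$. For $\epsilon,\epsilon'\in\mathbb{R}$, $\zeta\in\mathbb{C}$, $\tau\in\mathbb{H}^2$, the theta function with characteristics is $$\theta[\epsilon,\epsilon'](\zeta,\tau)=\sum_{n\in\mathbb{Z}}\exp\left(2\pi i\left[\tfrac12\left(n+\tfrac{\epsilon}{2}\right)^2\tau+\left(n+\tfrac{\epsilon}{2}\right)\left(\zeta+\tfrac{\epsilon'}{2}\right)\right]\right).$$ Write $\theta[\epsilon,\epsilon']=\theta[\epsilon,\epsilon'](0,\tau)$ and $\theta'[\epsilon,\epsilon']=\frac{\partial}{\partial\zeta}\theta[\epsilon,\epsilon'](\zeta,\tau)\big|_{\zeta=0}$; $\theta^k[\epsilon,\epsilon']$ means the $k$-th power of $\theta[\epsilon,\epsilon']$. *)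

theory Defs
  imports "HOL-Analysis.Analysis"
begin

text \<open>
  The series converges absolutely for \<open>Im \<tau> > 0\<close>, so the unordered sum over the integers is the
  usual bilateral sum. For other \<open>\<tau>\<close> nothing is claimed about the value.
\<close>

definition theta :: "real \<Rightarrow> real \<Rightarrow> complex \<Rightarrow> complex \<Rightarrow> complex" where
  "theta \<epsilon> \<epsilon>' \<zeta> \<tau> =
     (\<Sum>\<^sub>\<infinity>n\<in>(UNIV :: int set).
        exp (2 * of_real pi * \<i> *
          (1 / 2 * (of_int n + of_real \<epsilon> / 2)\<^sup>2 * \<tau>
           + (of_int n + of_real \<epsilon> / 2) * (\<zeta> + of_real \<epsilon>' / 2))))"

definition theta_const :: "real \<Rightarrow> real \<Rightarrow> complex \<Rightarrow> complex" where
  "theta_const \<epsilon> \<epsilon>' \<tau> = theta \<epsilon> \<epsilon>' 0 \<tau>"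

definition theta_deriv :: "real \<Rightarrow> real \<Rightarrow> complex \<Rightarrow> complex" where
  "theta_deriv \<epsilon> \<epsilon>' \<tau> = deriv (\<lambda>\<zeta>. theta \<epsilon> \<epsilon>' \<zeta> \<tau>) 0"

definition root_zeta :: "nat \<Rightarrow> complex" where
  "root_zeta k = exp (2 * of_real pi * \<i> / of_nat k)"

end

theory Submission
  imports Defs "HOL-Complex_Analysis.Cauchy_Integral_Formula"
begin

text \<open>
  Write \<open>\<theta>\<^sub>1, \<theta>\<^sub>2, \<theta>\<^sub>3, \<theta>\<^sub>4\<close> for the theta functions with characteristics \<open>[1,1]\<close>, \<open>[1,0]\<close>, \<open>[0,0]\<close>,
  \<open>[0,1]\<close>, so that \<open>\<theta>\<^sub>1\<close> is odd and the others are even, and let \<open>p = -(\<tau> + 1)/3\<close>; then \<open>3 p\<close> is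
  in the lattice \<open>\<int> + \<int>\<tau>\<close>.  Lowering both characteristics by \<open>2/3\<close> amounts to moving the argument by \<open>p\<close> and
  multiplying by an exponential.  Hence \<open>\<theta>[1/3,1/3]\<close>, \<open>\<theta>[2/3,5/3]\<close>, \<open>\<theta>[1/3,4/3]\<close>, \<open>\<theta>[2/3,2/3]\<close> are
  \<open>\<theta>\<^sub>1(p)\<close>, \<open>\<theta>\<^sub>4(p)\<close>, \<open>\<theta>\<^sub>2(p)\<close>, \<open>\<theta>\<^sub>3(p)\<close> up to constants, which leave only a cube root of unity and a
  sign in the quotients of the theorem, and the left-hand side is \<open>\<theta>\<^sub>1'/\<theta>\<^sub>1(p) - 2\<pi>\<i>/3\<close>.  Now write

    \<open>\<theta>\<^sub>1'/\<theta>\<^sub>1 = (\<theta>\<^sub>1'/\<theta>\<^sub>1 - \<theta>\<^sub>4'/\<theta>\<^sub>4) + \<theta>\<^sub>4'/\<theta>\<^sub>4\<close>.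

  The bracket is \<open>\<theta>\<^sub>1'(0) \<theta>\<^sub>4(0) / (\<theta>\<^sub>2(0) \<theta>\<^sub>3(0)) * \<theta>\<^sub>2(x) \<theta>\<^sub>3(x) / (\<theta>\<^sub>1(x) \<theta>\<^sub>4(x))\<close> wherever it is defined
  (\<open>theta1_theta4_wronskian\<close>; in Jacobi's notation it is the logarithmic derivative of \<open>sn\<close>), which at \<open>p\<close> is
  the second term of the theorem.  For \<open>\<theta>\<^sub>4'/\<theta>\<^sub>4\<close> there is the duplication formula

    \<open>2 \<theta>\<^sub>4'/\<theta>\<^sub>4(x) - \<theta>\<^sub>4'/\<theta>\<^sub>4(2x) = \<theta>\<^sub>1'(0) \<theta>\<^sub>1(2x) \<theta>\<^sub>1(x)\<^sup>2 / (\<theta>\<^sub>4(0) \<theta>\<^sub>4(2x) \<theta>\<^sub>4(x)\<^sup>2)\<close>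

  (\<open>theta4_log_derivative_duplication\<close>).  Since \<open>2 p\<close> equals \<open>-p\<close> up to a lattice vector, quasi-periodicity
  turns its two sides at \<open>x = p\<close> into \<open>3 \<theta>\<^sub>4'/\<theta>\<^sub>4(p) - 2\<pi>\<i>\<close> and \<open>\<theta>\<^sub>1'(0) \<theta>\<^sub>1(p)\<^sup>3 / (\<theta>\<^sub>4(0) \<theta>\<^sub>4(p)\<^sup>3)\<close>
  (\<open>theta_3_torsion\<close>).  The constants \<open>2\<pi>\<i>/3\<close> cancel, and the first equality follows.

  Both identities rest on \<open>theta_product_formula\<close>, which expands \<open>\<theta>(x + y) \<theta>(x - y)\<close> as a sum of two
  products of a function of \<open>x\<close> and a function of \<open>y\<close>.  Differentiating in \<open>y\<close> gives Wronskians of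
  theta functions in the same separated form, and only polynomial algebra remains.

  The second equality is Jacobi's derivative formula \<open>\<theta>\<^sub>1'(0) = -\<pi> \<theta>\<^sub>2(0) \<theta>\<^sub>3(0) \<theta>\<^sub>4(0)\<close>.  It is read off
  from Jacobi's triple product, which also shows that none of the denominators vanishes.  The
  triple product is the limit of a finite identity, a form of the \<open>q\<close>-binomial theorem.
\<close>

section \<open>Theta series and their characteristics\<close>

lemma summable_on_int_geometric:
  fixes x :: real
  assumes "0 \<le> x" "x < 1"
  shows "(\<lambda>n::int. x ^ nat \<bar>n\<bar>) summable_on UNIV"
proof -
  have nat: "(\<lambda>n::nat. x ^ n) summable_on UNIV"
    using assms by (intro norm_summable_imp_summable_on) (auto intro: summable_geometric)
  have "(\<lambda>n::int. x ^ nat \<bar>n\<bar>) summable_on {0..}"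
    using nat
    by (subst summable_on_reindex_bij_betw[of int UNIV "{0..}", symmetric])
       (auto simp: bij_betw_def image_iff intro: zero_le_imp_eq_int)
  moreover have "(\<lambda>n::int. x ^ nat \<bar>n\<bar>) summable_on {..0}"
    using nat
    by (subst summable_on_reindex_bij_betw[of "\<lambda>n. - int n" UNIV "{..0}", symmetric])
       (auto simp: bij_betw_def image_iff inj_on_def intro: nonpos_int_cases)
  ultimately have "(\<lambda>n::int. x ^ nat \<bar>n\<bar>) summable_on ({0..} \<union> {..0})"
    by (rule summable_on_union)
  also have "{0..} \<union> {..0} = (UNIV :: int set)"
    by auto
  finally show ?thesis .
qed

text \<open>
  Completing the square bounds the exponent by a constant minus \<open>\<bar>n\<bar>\<close>.  The linear term absorbs the
  dependence on the argument of a theta series, which makes the bound uniform on strips.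
\<close>

lemma summable_on_int_gaussian:
  fixes t r e :: real
  assumes "t > 0"
  shows "(\<lambda>n::int. exp (r * \<bar>of_int n + e\<bar> - t * (of_int n + e)\<^sup>2)) summable_on UNIV"
proof (rule summable_on_comparison_test)
  define K where "K = exp ((r + 1)\<^sup>2 / (4 * t) + \<bar>e\<bar>)"
  show "(\<lambda>n::int. K * exp (-1) ^ nat \<bar>n\<bar>) summable_on UNIV"
    by (intro summable_on_cmult_right summable_on_int_geometric) auto
  fix n :: int
  define c where "c = \<bar>of_int n + e\<bar>"
  have "(r + 1) * c - t * c\<^sup>2 \<le> (r + 1)\<^sup>2 / (4 * t)"
  proof -
    have "(r + 1)\<^sup>2 / (4 * t) - ((r + 1) * c - t * c\<^sup>2) = t * (c - (r + 1) / (2 * t))\<^sup>2"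
      using assms by (simp add: field_simps power2_eq_square)
    also have "\<dots> \<ge> 0"
      using assms by simp
    finally show ?thesis by linarith
  qed
  moreover have "\<bar>of_int n\<bar> \<le> c + \<bar>e\<bar>"
    unfolding c_def by linarith
  ultimately have "r * c - t * c\<^sup>2 \<le> ((r + 1)\<^sup>2 / (4 * t) + \<bar>e\<bar>) - \<bar>of_int n\<bar>"
    by (simp add: algebra_simps)
  hence "exp (r * c - t * c\<^sup>2) \<le> K * exp (- \<bar>of_int n\<bar>)"
    unfolding K_def by (simp flip: exp_add)
  also have "exp (- \<bar>of_int n\<bar>) = exp (-1 :: real) ^ nat \<bar>n\<bar>"
    by (simp flip: exp_of_nat_mult)
  finally show "exp (r * \<bar>of_int n + e\<bar> - t * (of_int n + e)\<^sup>2) \<le> K * exp (-1) ^ nat \<bar>n\<bar>"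
    by (simp add: c_def)
qed auto

definition theta_term :: "real \<Rightarrow> real \<Rightarrow> complex \<Rightarrow> complex \<Rightarrow> int \<Rightarrow> complex" where
  "theta_term \<epsilon> \<epsilon>' \<zeta> \<tau> n = exp (2 * of_real pi * \<i> *
     (1 / 2 * (of_int n + of_real \<epsilon> / 2)\<^sup>2 * \<tau>
      + (of_int n + of_real \<epsilon> / 2) * (\<zeta> + of_real \<epsilon>' / 2)))"

lemma norm_theta_term:
  "norm (theta_term \<epsilon> \<epsilon>' \<zeta> \<tau> n) =
     exp (- 2 * pi * Im \<zeta> * (of_int n + \<epsilon> / 2) - pi * Im \<tau> * (of_int n + \<epsilon> / 2)\<^sup>2)"
proof -
  define c where "c = of_int n + \<epsilon> / 2"
  have "of_int n + of_real \<epsilon> / 2 = complex_of_real c"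
    by (simp add: c_def)
  hence "norm (theta_term \<epsilon> \<epsilon>' \<zeta> \<tau> n) =
      norm (exp (2 * of_real pi * \<i> * (1 / 2 * (of_real c)\<^sup>2 * \<tau> + of_real c * (\<zeta> + of_real \<epsilon>' / 2))))"
    by (simp add: theta_term_def)
  also have "\<dots> = exp (- 2 * pi * Im \<zeta> * c - pi * Im \<tau> * c\<^sup>2)"
    by (simp add: algebra_simps power2_eq_square)
  finally show ?thesis by (simp add: c_def)
qed

lemma abs_summable_theta_term:
  assumes "Im \<tau> > 0"
  shows "(\<lambda>n. norm (theta_term \<epsilon> \<epsilon>' \<zeta> \<tau> n)) summable_on UNIV"
proof (rule summable_on_comparison_test)
  show "(\<lambda>n::int. exp (2 * pi * \<bar>Im \<zeta>\<bar> * \<bar>of_int n + \<epsilon> / 2\<bar> -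
          pi * Im \<tau> * (of_int n + \<epsilon> / 2)\<^sup>2)) summable_on UNIV"
    by (rule summable_on_int_gaussian) (use assms in auto)
next
  fix n :: int
  have "- (Im \<zeta> * (of_int n + \<epsilon> / 2)) \<le> \<bar>Im \<zeta>\<bar> * \<bar>of_int n + \<epsilon> / 2\<bar>"
    by (metis abs_ge_minus_self abs_mult)
  from mult_left_mono[OF this, of "2 * pi"]
  show "norm (theta_term \<epsilon> \<epsilon>' \<zeta> \<tau> n) \<le> exp (2 * pi * \<bar>Im \<zeta>\<bar> * \<bar>of_int n + \<epsilon> / 2\<bar> -
          pi * Im \<tau> * (of_int n + \<epsilon> / 2)\<^sup>2)"
    unfolding norm_theta_term by (simp add: algebra_simps)
qed auto

lemma theta_has_sum:
  assumes "Im \<tau> > 0"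
  shows "(theta_term \<epsilon> \<epsilon>' \<zeta> \<tau> has_sum theta \<epsilon> \<epsilon>' \<zeta> \<tau>) UNIV"
proof -
  have "theta_term \<epsilon> \<epsilon>' \<zeta> \<tau> summable_on UNIV"
    using abs_summable_theta_term[OF assms] by (rule abs_summable_summable)
  thus ?thesis
    by (simp add: has_sum_iff theta_def theta_term_def[abs_def])
qed

text \<open>
  Every functional equation in the characteristics, the argument and their signs comes from a
  termwise identity after a relabelling of the summation index.
\<close>

lemma theta_eqI:
  assumes "Im \<tau> > 0"
    and "\<And>n. theta_term \<epsilon> \<epsilon>' \<zeta> \<tau> n = c * theta_term \<delta> \<delta>' \<xi> \<tau> (h n)" and "bij h"
  shows "theta \<epsilon> \<epsilon>' \<zeta> \<tau> = c * theta \<delta> \<delta>' \<xi> \<tau>"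
proof (rule has_sum_unique)
  have "((\<lambda>n. theta_term \<delta> \<delta>' \<xi> \<tau> (h n)) has_sum theta \<delta> \<delta>' \<xi> \<tau>) UNIV"
    by (subst has_sum_reindex_bij_betw[OF \<open>bij h\<close>]) (rule theta_has_sum[OF assms(1)])
  from has_sum_cmult_right[OF this, of c]
  show "(theta_term \<epsilon> \<epsilon>' \<zeta> \<tau> has_sum c * theta \<delta> \<delta>' \<xi> \<tau>) UNIV"
    by (simp add: assms(2)[abs_def] cong: has_sum_cong)
qed (rule theta_has_sum[OF assms(1)])

text \<open>
  The characteristics are coordinates on the plane: a change \<open>(a, b)\<close> of them is a translation of the
  argument by \<open>(a \<tau> + b)/2\<close>.  With even integers \<open>a, b\<close> this is quasi-periodicity, and with
  \<open>a = b = -2/3\<close> it leads to the points of order three.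
\<close>

lemma theta_shift:
  assumes "Im \<tau> > 0"
  shows "theta (\<epsilon> + a) (\<epsilon>' + b) \<zeta> \<tau> =
    exp (2 * of_real pi * \<i> *
      (of_real a ^ 2 * \<tau> / 8 + of_real a / 2 * (\<zeta> + (of_real \<epsilon>' + of_real b) / 2)))
    * theta \<epsilon> \<epsilon>' (\<zeta> + of_real a * \<tau> / 2 + of_real b / 2) \<tau>"
  by (rule theta_eqI[OF assms, of _ _ _ _ _ _ _ id])
     (auto simp: theta_term_def algebra_simps power2_eq_square add_divide_distrib simp flip: exp_add)

lemma theta_add_2_left:
  assumes "Im \<tau> > 0"
  shows "theta (\<epsilon> + 2) \<epsilon>' \<zeta> \<tau> = theta \<epsilon> \<epsilon>' \<zeta> \<tau>"
proof -
  have "bij (\<lambda>n::int. n + 1)"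
    by (intro bij_plus_right)
  from theta_eqI[OF assms _ this, of "\<epsilon> + 2" \<epsilon>' \<zeta> 1 \<epsilon> \<epsilon>' \<zeta>] show ?thesis
    by (simp add: theta_term_def algebra_simps add_divide_distrib)
qed

lemma theta_add_2_right:
  assumes "Im \<tau> > 0"
  shows "theta \<epsilon> (\<epsilon>' + 2) \<zeta> \<tau> = exp (of_real pi * \<i> * of_real \<epsilon>) * theta \<epsilon> \<epsilon>' \<zeta> \<tau>"
proof (rule theta_eqI[OF assms, of _ _ _ _ _ _ _ id])
  fix n :: int
  have 1: "exp (2 * of_real pi * \<i> * of_int n) = 1"
    by (simp add: exp_eq_1 mult_ac)
  show "theta_term \<epsilon> (\<epsilon>' + 2) \<zeta> \<tau> n =
          exp (of_real pi * \<i> * of_real \<epsilon>) * theta_term \<epsilon> \<epsilon>' \<zeta> \<tau> (id n)"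
  proof -
    have "theta_term \<epsilon> (\<epsilon>' + 2) \<zeta> \<tau> n = exp (2 * of_real pi * \<i> * of_int n) *
            (exp (of_real pi * \<i> * of_real \<epsilon>) * theta_term \<epsilon> \<epsilon>' \<zeta> \<tau> n)"
      unfolding theta_term_def mult_exp_exp
      by (intro arg_cong[of _ _ exp]) (simp add: algebra_simps add_divide_distrib)
    thus ?thesis by (simp only: 1 mult_1 id_apply)
  qed
qed auto

lemma theta_uminus:
  assumes "Im \<tau> > 0"
  shows "theta (- \<epsilon>) (- \<epsilon>') (- \<zeta>) \<tau> = theta \<epsilon> \<epsilon>' \<zeta> \<tau>"
proof -
  have "bij (uminus :: int \<Rightarrow> int)"
    by (rule bij_uminus)
  from theta_eqI[OF assms _ this, of "- \<epsilon>" "- \<epsilon>'" "- \<zeta>" 1 \<epsilon> \<epsilon>' \<zeta>] show ?thesis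
    by (simp add: theta_term_def algebra_simps power2_eq_square)
qed

lemma theta_1_1_uminus:
  assumes "Im \<tau> > 0"
  shows "theta 1 1 (- \<zeta>) \<tau> = - theta 1 1 \<zeta> \<tau>"
  using theta_uminus[OF assms, of 1 1 \<zeta>] theta_add_2_left[OF assms, of "-1" "-1" "- \<zeta>"]
    theta_add_2_right[OF assms, of 1 "-1" "- \<zeta>"] by simp

lemma theta_1_1_0: "Im \<tau> > 0 \<Longrightarrow> theta 1 1 0 \<tau> = 0"
  using theta_1_1_uminus[of \<tau> 0] by simp

section \<open>The q-binomial theorem\<close>

text \<open>
  The finite product \<open>(x; x)\<^sub>n\<close>.  It differs from the usual \<open>q\<close>-factorial by a power of \<open>1 - x\<close>, which
  cancels in the Gaussian binomial coefficient below.
\<close>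

definition qfact :: "complex \<Rightarrow> nat \<Rightarrow> complex" where
  "qfact x n = (\<Prod>i<n. 1 - x ^ Suc i)"

definition qbinom :: "complex \<Rightarrow> nat \<Rightarrow> nat \<Rightarrow> complex" where
  "qbinom x n k = (if k \<le> n then qfact x n / (qfact x k * qfact x (n - k)) else 0)"

lemma one_plus_power_neq_0:
  fixes x :: complex
  assumes "norm x < 1"
  shows "1 + x ^ Suc i \<noteq> 0" "1 - x ^ Suc i \<noteq> 0"
proof -
  have *: "norm (x ^ Suc i) < 1"
    using assms unfolding norm_power by (subst power_less_one_iff) auto
  show "1 + x ^ Suc i \<noteq> 0"
    using * by (metis add.inverse_inverse add_eq_0_iff norm_minus_cancel norm_one order_less_irrefl)
  show "1 - x ^ Suc i \<noteq> 0"
    using * by (metis eq_iff_diff_eq_0 norm_one order_less_irrefl)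
qed

lemma qfact_nonzero: "norm x < 1 \<Longrightarrow> qfact x n \<noteq> 0"
  unfolding qfact_def prod_zero_iff[OF finite_lessThan] using one_plus_power_neq_0(2) by blast

text \<open>
  Of the two Pascal rules this is the one with the power on the lower coefficient, as required when
  a factor \<open>1 + x ^ n * y\<close> is appended to the product in the \<open>q\<close>-binomial theorem.
\<close>

lemma qbinom_Suc_Suc:
  assumes "norm x < 1" "k \<le> n"
  shows "qbinom x (Suc n) (Suc k) = qbinom x n (Suc k) + x ^ (n - k) * qbinom x n k"
proof (cases "k = n")
  case True
  moreover have "qfact x 0 = 1" by (simp add: qfact_def)
  ultimately show ?thesis using qfact_nonzero[OF assms(1)] by (simp add: qbinom_def)
next
  case False
  then obtain m where m: "n = k + Suc m"
    using assms(2) by (metis add_Suc_right le_neq_implies_less less_imp_Suc_add)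
  have "qfact x (Suc m) = qfact x m * (1 - x ^ Suc m)"
       "qfact x (Suc k) = qfact x k * (1 - x ^ Suc k)"
       "qfact x (Suc n) = qfact x n * (1 - x ^ Suc m * x ^ Suc k)"
    by (simp_all add: qfact_def m power_add)
  moreover have "qfact x m \<noteq> 0" "qfact x k \<noteq> 0" "1 - x ^ Suc m \<noteq> 0" "1 - x ^ Suc k \<noteq> 0"
    using assms(1) qfact_nonzero one_plus_power_neq_0(2) by blast+
  ultimately show ?thesis
    by (simp add: qbinom_def m divide_simps del: power_Suc) (simp add: algebra_simps)
qed

theorem q_binomial_theorem:
  assumes "norm x < 1"
  shows "(\<Prod>k<n. 1 + x ^ k * y) = (\<Sum>j\<le>n. qbinom x n j * x ^ (j choose 2) * y ^ j)"
proof (induction n)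
  case 0
  show ?case by (simp add: qbinom_def qfact_def numeral_2_eq_2)
next
  case (Suc n)
  define b where "b = (\<lambda>n j. qbinom x n j * x ^ (j choose 2))"
  have b0: "b m 0 = 1" for m
    using qfact_nonzero[OF assms] by (simp add: b_def qbinom_def qfact_def numeral_2_eq_2)
  have bS: "b (Suc n) (Suc j) = b n (Suc j) + x ^ n * b n j" if "j \<le> n" for j
  proof -
    have "x ^ n = x ^ (n - j) * x ^ j"
      using that by (simp flip: power_add)
    thus ?thesis
      by (simp add: b_def qbinom_Suc_Suc[OF assms that] numeral_2_eq_2 power_add algebra_simps)
  qed
  have "(\<Sum>j\<le>n. b n j * y ^ j) = (\<Sum>j\<le>Suc n. b n j * y ^ j)"
    by (simp add: b_def qbinom_def)
  also have "\<dots> = 1 + (\<Sum>j\<le>n. b n (Suc j) * y ^ Suc j)"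
    by (subst sum.atMost_Suc_shift) (simp add: b0)
  finally have 1: "(\<Sum>j\<le>n. b n j * y ^ j) = 1 + (\<Sum>j\<le>n. b n (Suc j) * y ^ Suc j)" .
  have "(\<Prod>k<Suc n. 1 + x ^ k * y) = (\<Sum>j\<le>n. b n j * y ^ j) * (1 + x ^ n * y)"
    using Suc by (simp add: b_def)
  also have "\<dots> = (\<Sum>j\<le>n. b n j * y ^ j) + (\<Sum>j\<le>n. x ^ n * b n j * y ^ Suc j)"
    by (simp add: distrib_left sum_distrib_left sum_distrib_right sum.distrib algebra_simps)
  also have "\<dots> = 1 + (\<Sum>j\<le>n. b (Suc n) (Suc j) * y ^ Suc j)"
    unfolding 1 by (simp add: bS algebra_simps sum.distrib del: power_Suc)
  also have "\<dots> = (\<Sum>j\<le>Suc n. b (Suc n) j * y ^ j)"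
    by (subst sum.atMost_Suc_shift) (simp add: b0)
  finally show ?case by (simp add: b_def)
qed

text \<open>
  In the \<open>q\<close>-binomial theorem with \<open>2 n\<close> factors, base \<open>q\<^sup>2\<close> and \<open>y = w q\<^bsup>1-2n\<^esup>\<close>, the upper half of the
  factors is \<open>1 + q\<^bsup>2i+1\<^esup> w\<close>, and the lower half becomes \<open>1 + q\<^bsup>2i+1\<^esup> / w\<close> after \<open>w / q\<^bsup>2i+1\<^esup>\<close> is taken out of
  each.  The summation index is centred, so that the exponents of \<open>q\<close> become squares.
\<close>

lemma finite_triple_product:
  fixes q w :: complex
  assumes "norm q < 1" "q \<noteq> 0" "w \<noteq> 0"
  shows "(\<Prod>i<n. (1 + q ^ (2 * i + 1) * w) * (1 + q ^ (2 * i + 1) / w)) =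
         (\<Sum>j\<in>{- int n..int n}. qbinom (q\<^sup>2) (2 * n) (nat (int n + j)) * (q powi (j\<^sup>2) * w powi j))"
proof -
  define y where "y = w * q / q ^ (2 * n)"
  have q2: "norm (q\<^sup>2) < 1"
    using assms by (simp add: norm_power power_less_one_iff)
  have c: "w ^ n / q ^ (n\<^sup>2) \<noteq> 0" 
    using assms by simp
  have "(\<Prod>k<2*n. 1 + (q\<^sup>2) ^ k * y) = (\<Prod>k<n. 1 + (q\<^sup>2) ^ k * y) * (\<Prod>k<n. 1 + (q\<^sup>2) ^ (k + n) * y)"
    using prod.nat_group[of "\<lambda>k. 1 + (q\<^sup>2) ^ k * y" n 2] by (simp add: numeral_2_eq_2 lessThan_Suc mult_ac atLeast0LessThan prod.shift_bounds_nat_ivl[of _ 0 n n, simplified])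
  also have "(\<Prod>k<n. 1 + (q\<^sup>2) ^ (k + n) * y) = (\<Prod>i<n. 1 + q ^ (2 * i + 1) * w)"
    using assms by (intro prod.cong refl)
      (simp add: y_def power_mult[symmetric] power_add distrib_left field_simps)
  also have "(\<Prod>k<n. 1 + (q\<^sup>2) ^ k * y) = (\<Prod>i<n. 1 + (q\<^sup>2) ^ (n - Suc i) * y)"
    by (rule prod.nat_diff_reindex[symmetric])
  also have "\<dots> = (\<Prod>i<n. w / q ^ (2 * i + 1) * (1 + q ^ (2 * i + 1) / w))"
  proof (intro prod.cong refl)
    fix i assume "i \<in> {..<n}"
    hence "2 * n = 2 * (n - Suc i) + (2 * i + 1) + 1" by auto
    hence "q ^ (2 * n) = (q\<^sup>2) ^ (n - Suc i) * q ^ (2 * i + 1) * q"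
      by (metis power_add power_mult power_one_right)
    thus "1 + (q\<^sup>2) ^ (n - Suc i) * y = w / q ^ (2 * i + 1) * (1 + q ^ (2 * i + 1) / w)"
      using assms by (simp add: y_def field_simps)
  qed
  also have "\<dots> = w ^ n / q ^ (n\<^sup>2) * (\<Prod>i<n. 1 + q ^ (2 * i + 1) / w)"
  proof -
    have "(\<Prod>i<n. w / q ^ (2 * i + 1)) = w ^ n / q ^ (n\<^sup>2)"
      by (induction n) (auto simp: power2_eq_square power_add power_mult field_simps)
    thus ?thesis by (simp only: prod.distrib)
  qed
  finally have "w ^ n / q ^ (n\<^sup>2) * (\<Prod>i<n. (1 + q ^ (2 * i + 1) * w) * (1 + q ^ (2 * i + 1) / w)) =
      (\<Prod>k<2*n. 1 + (q\<^sup>2) ^ k * y)"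
    by (simp add: prod.distrib mult_ac)
  also have "\<dots> = (\<Sum>j\<le>2*n. qbinom (q\<^sup>2) (2*n) j * (q\<^sup>2) ^ (j choose 2) * y ^ j)"
    by (rule q_binomial_theorem[OF q2])
  also have "\<dots> = (\<Sum>j\<in>{- int n..int n}. w ^ n / q ^ (n\<^sup>2) *
      (qbinom (q\<^sup>2) (2 * n) (nat (int n + j)) * (q powi (j\<^sup>2) * w powi j)))"
  proof (rule sum.reindex_bij_witness[of _ "\<lambda>j. nat (int n + j)" "\<lambda>j. int j - int n"])
    fix j assume "j \<in> {..2*n}"
    have "2 * (j choose 2) + j = j\<^sup>2"
      by (induction j) (auto simp: numeral_2_eq_2 power2_eq_square)
    hence "(q\<^sup>2) ^ (j choose 2) * y ^ j = q ^ (j\<^sup>2) * w ^ j / q ^ (2 * n * j)"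
    proof -
      have "(q\<^sup>2) ^ (j choose 2) * y ^ j = q ^ (2 * (j choose 2) + j) * w ^ j / q ^ (2 * n * j)"
        unfolding y_def power_divide power_mult_distrib power_add power_mult[symmetric] by simp
      thus ?thesis using \<open>2 * (j choose 2) + j = j\<^sup>2\<close> by simp
    qed
    also have "\<dots> = w ^ n / q ^ (n\<^sup>2) * (q powi ((int j - int n)\<^sup>2) * w powi (int j - int n))"
    proof -
      have "q powi ((int j - int n)\<^sup>2) = q powi (int (j\<^sup>2) + int (n\<^sup>2) - int (2 * n * j))"
        by (rule arg_cong[of _ _ "(powi) q"]) (simp add: power2_eq_square algebra_simps)
      also have "\<dots> = q ^ (j\<^sup>2) * q ^ (n\<^sup>2) / q ^ (2 * n * j)"
      proof -
        have "q powi (int a + int b - int c) = q ^ a * q ^ b / q ^ c" for a b c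
          using assms by (simp add: power_int_diff power_int_add)
        thus ?thesis .
      qed
      finally show ?thesis
        using assms by (simp add: power_int_diff)
    qed
    finally have E: "(q\<^sup>2) ^ (j choose 2) * y ^ j =
        w ^ n / q ^ (n\<^sup>2) * (q powi ((int j - int n)\<^sup>2) * w powi (int j - int n))" .
    show "w ^ n / q ^ (n\<^sup>2) * (qbinom (q\<^sup>2) (2 * n) (nat (int n + (int j - int n))) *
            (q powi ((int j - int n)\<^sup>2) * w powi (int j - int n))) =
          qbinom (q\<^sup>2) (2*n) j * (q\<^sup>2) ^ (j choose 2) * y ^ j"
      unfolding mult.assoc E by simp
  qed auto
  finally show ?thesis
    using c unfolding sum_distrib_left[symmetric] mult_cancel_left by blast
qed

section \<open>Jacobi's triple product\<close>

text \<open>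
  Dominated convergence for unordered sums: by the majorant the finite partial sums converge
  uniformly in \<open>n\<close>, so the two limits may be exchanged.
\<close>

lemma infsum_dominated_tendsto_0:
  fixes a :: "nat \<Rightarrow> 'a \<Rightarrow> real"
  assumes M: "M summable_on UNIV"
    and le: "\<And>n j. \<bar>a n j\<bar> \<le> M j"
    and lim: "\<And>j. (\<lambda>n. a n j) \<longlonglongrightarrow> 0"
  shows "(\<lambda>n. \<Sum>\<^sub>\<infinity>j. a n j) \<longlonglongrightarrow> 0"
proof (rule swap_uniform_limit')
  show "\<forall>\<^sub>F X in finite_subsets_at_top UNIV. (\<lambda>n. \<Sum>j\<in>X. a n j) \<longlonglongrightarrow> 0"
    by (intro always_eventually allI tendsto_null_sum lim)
  show "uniform_limit UNIV (\<lambda>X n. \<Sum>j\<in>X. a n j) (\<lambda>n. \<Sum>\<^sub>\<infinity>j. a n j) (finite_subsets_at_top UNIV)"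
    using M by (intro Weierstrass_m_test_general) (auto simp: le)
qed auto

lemma summable_norm_power_linear:
  fixes q :: complex
  assumes "norm q < 1"
  shows "summable (\<lambda>i. norm (c * q ^ (a + Suc b * i)))"
proof -
  have "norm (q ^ Suc b) < 1"
    using assms unfolding norm_power by (subst power_less_one_iff) auto
  hence "summable (\<lambda>i. norm c * norm q ^ a * norm (q ^ Suc b) ^ i)"
    by (intro summable_mult summable_geometric) auto
  thus ?thesis
    by (simp only: norm_mult norm_power power_add power_mult mult.assoc)
qed

text \<open>
  The shape of the exponent covers all exponents that occur: \<open>Suc i\<close> and \<open>2 * i + 1\<close>.
\<close>

lemma convergent_prod_one_plus_power:
  fixes q :: complex
  assumes "norm q < 1"
  shows "convergent_prod (\<lambda>i. 1 + c * q ^ (a + Suc b * i))"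
  using summable_norm_power_linear[OF assms]
  by (intro abs_convergent_prod_imp_convergent_prod summable_imp_abs_convergent_prod) simp

lemma prod_LIMSEQ_prodinf:
  fixes f :: "nat \<Rightarrow> complex"
  assumes "convergent_prod f"
  shows "(\<lambda>n. \<Prod>i<n. f i) \<longlonglongrightarrow> prodinf f"
  using convergent_prod_LIMSEQ[OF assms]
  by (subst filterlim_sequentially_Suc[symmetric]) (simp add: lessThan_Suc_atMost)

definition qfact_inf :: "complex \<Rightarrow> complex" where
  "qfact_inf x = (\<Prod>i. 1 - x ^ Suc i)"

lemma
  assumes "norm x < 1"
  shows qfact_LIMSEQ: "qfact x \<longlonglongrightarrow> qfact_inf x"
    and qfact_inf_nonzero: "qfact_inf x \<noteq> 0"
proof -
  have conv: "convergent_prod (\<lambda>i. 1 - x ^ Suc i)"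
    using convergent_prod_one_plus_power[OF assms, of "-1" 1 0] by simp
  show "qfact x \<longlonglongrightarrow> qfact_inf x"
    using prod_LIMSEQ_prodinf[OF conv] by (simp add: qfact_def[abs_def] qfact_inf_def)
  show "qfact_inf x \<noteq> 0"
    unfolding qfact_inf_def
    by (rule prodinf_nonzero[OF conv]) (rule one_plus_power_neq_0(2)[OF assms])
qed

text \<open>
  The bound is uniform because \<open>(x; x)\<^sub>n\<close> converges to a limit other than zero, so that it is bounded
  and bounded away from zero.
\<close>

lemma qbinom_bounded:
  assumes "norm x < 1"
  obtains B where "\<And>n k. norm (qbinom x n k) \<le> B"
proof -
  have "Bseq (qfact x)"
    using qfact_LIMSEQ[OF assms] by (intro convergent_imp_Bseq) (auto simp: convergent_def)
  then obtain K where K: "\<And>n. norm (qfact x n) \<le> K" "K > 0"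
    by (auto simp: Bseq_def)
  have "Bseq (\<lambda>n. inverse (qfact x n))"
    using tendsto_inverse[OF qfact_LIMSEQ[OF assms] qfact_inf_nonzero[OF assms]]
    by (intro convergent_imp_Bseq) (auto simp: convergent_def)
  then obtain L where L: "\<And>n. norm (inverse (qfact x n)) \<le> L" "L > 0"
    by (auto simp: Bseq_def)
  have "norm (qbinom x n k) \<le> K * (L * L)" for n k
  proof (cases "k \<le> n")
    case True
    hence "norm (qbinom x n k) =
        norm (qfact x n) * (norm (inverse (qfact x k)) * norm (inverse (qfact x (n - k))))"
      by (simp add: qbinom_def norm_mult norm_divide norm_inverse field_simps)
    also have "\<dots> \<le> K * (L * L)"
      using K L by (intro mult_mono mult_nonneg_nonneg) (auto intro: order.strict_implies_order)
    finally show ?thesis .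
  qed (use K L in \<open>simp add: qbinom_def\<close>)
  thus ?thesis by (rule that)
qed

lemma central_qbinom_LIMSEQ:
  assumes "norm x < 1"
  shows "(\<lambda>n. qbinom x (2 * n) (nat (int n + j))) \<longlonglongrightarrow> 1 / qfact_inf x"
proof -
  define Q where "Q = qfact_inf x"
  have Q: "Q \<noteq> 0" "qfact x \<longlonglongrightarrow> Q"
    using qfact_LIMSEQ[OF assms] qfact_inf_nonzero[OF assms] by (simp_all add: Q_def)
  have at_top: "filterlim (\<lambda>n::nat. nat (int n + i)) at_top at_top" for i
  proof (rule filterlim_at_top_mono[where f = "\<lambda>n. n - nat \<bar>i\<bar>"])
    show "filterlim (\<lambda>n. n - nat \<bar>i\<bar>) at_top at_top"
      by (rule filterlim_minus_const_nat_at_top)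
  qed (auto intro!: always_eventually)
  have "(\<lambda>n. qfact x (2 * n) / (qfact x (nat (int n + j)) * qfact x (nat (int n + (-j)))))
           \<longlonglongrightarrow> Q / (Q * Q)"
    using Q(1)
    by (intro tendsto_divide tendsto_mult filterlim_compose[OF Q(2)] at_top mult_nat_left_at_top) auto
  moreover have "\<forall>\<^sub>F n in sequentially. qfact x (2 * n) / (qfact x (nat (int n + j)) * qfact x (nat (int n + (-j))))
      = qbinom x (2 * n) (nat (int n + j))"
    using eventually_ge_at_top[of "nat \<bar>j\<bar>"]
  proof eventually_elim
    case (elim n)
    hence "nat (int n + j) \<le> 2 * n" "2 * n - nat (int n + j) = nat (int n - j)"
      by linarith+
    thus ?case by (simp add: qbinom_def)
  qed
  ultimately have "(\<lambda>n. qbinom x (2 * n) (nat (int n + j))) \<longlonglongrightarrow> Q / (Q * Q)"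
    by (rule Lim_transform_eventually)
  thus ?thesis using Q(1) by (simp add: Q_def)
qed

definition nome :: "complex \<Rightarrow> complex" where
  "nome \<tau> = exp (of_real pi * \<i> * \<tau>)"

lemma nome_nonzero [simp]: "nome \<tau> \<noteq> 0"
  by (simp add: nome_def)

lemma norm_nome_less_1: "Im \<tau> > 0 \<Longrightarrow> norm (nome \<tau>) < 1"
  by (simp add: nome_def)

lemma norm_nome_power2_less_1: "Im \<tau> > 0 \<Longrightarrow> norm (nome \<tau> ^ 2) < 1"
  using norm_nome_less_1 unfolding norm_power by (subst power_less_one_iff) auto

text \<open>
  The \<open>n\<close>-th partial product in Jacobi's triple product, without the factor \<open>(q\<^sup>2; q\<^sup>2)\<^sub>\<infinity>\<close>.
\<close>

definition triple_prod :: "nat \<Rightarrow> complex \<Rightarrow> complex \<Rightarrow> complex" where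
  "triple_prod n \<zeta> \<tau> = (\<Prod>i<n. (1 + nome \<tau> ^ (2 * i + 1) * exp (2 * of_real pi * \<i> * \<zeta>)) *
                             (1 + nome \<tau> ^ (2 * i + 1) * exp (- (2 * of_real pi * \<i> * \<zeta>))))"

lemma triple_prod_conv_theta_term:
  assumes "Im \<tau> > 0"
  shows "triple_prod n \<zeta> \<tau> =
    (\<Sum>j\<in>{- int n..int n}. qbinom (nome \<tau> ^ 2) (2 * n) (nat (int n + j)) * theta_term 0 0 \<zeta> \<tau> j)"
proof -
  have "triple_prod n \<zeta> \<tau> = (\<Prod>i<n. (1 + nome \<tau> ^ (2 * i + 1) * exp (2 * of_real pi * \<i> * \<zeta>)) *
                             (1 + nome \<tau> ^ (2 * i + 1) / exp (2 * of_real pi * \<i> * \<zeta>)))"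
    by (simp add: triple_prod_def exp_minus field_simps)
  also have "\<dots> = (\<Sum>j\<in>{- int n..int n}. qbinom (nome \<tau> ^ 2) (2 * n) (nat (int n + j)) *
       (nome \<tau> powi (j\<^sup>2) * exp (2 * of_real pi * \<i> * \<zeta>) powi j))"
    by (rule finite_triple_product[OF norm_nome_less_1[OF assms]]) auto
  moreover have "nome \<tau> powi (j\<^sup>2) * exp (2 * of_real pi * \<i> * \<zeta>) powi j = theta_term 0 0 \<zeta> \<tau> j" for j
    unfolding nome_def theta_term_def exp_power_int mult_exp_exp
    by (intro arg_cong[of _ _ exp]) (simp add: algebra_simps)
  ultimately show ?thesis by simp
qed

text \<open>
  Term by term, the coefficients in \<open>triple_prod_conv_theta_term\<close> tend to \<open>1 / (q\<^sup>2; q\<^sup>2)\<^sub>\<infinity>\<close> and stay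
  bounded.  On a disc all theta terms have a common summable majorant, so the difference of the
  two sides is at most a single number, independent of \<open>\<zeta>\<close>, which tends to zero by dominated
  convergence.  Uniformity is what allows the passage to derivatives.
\<close>

theorem jacobi_triple_product_uniform:
  assumes "Im \<tau> > 0"
  shows "uniform_limit (cball \<zeta>\<^sub>0 R) (\<lambda>n \<zeta>. triple_prod n \<zeta> \<tau>)
           (\<lambda>\<zeta>. theta 0 0 \<zeta> \<tau> / qfact_inf (nome \<tau> ^ 2)) sequentially"
proof -
  define x where "x = nome \<tau> ^ 2"
  have x: "norm x < 1"
    unfolding x_def by (rule norm_nome_power2_less_1[OF assms])
  define Q where "Q = qfact_inf x"
  define c where "c = (\<lambda>n j. if j \<in> {- int n..int n} then qbinom x (2 * n) (nat (int n + j)) else 0)"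
  define I where "I = \<bar>Im \<zeta>\<^sub>0\<bar> + R"
  define M where "M = (\<lambda>j::int. exp (2 * pi * I * \<bar>of_int j + 0\<bar> - pi * Im \<tau> * (of_int j + 0)\<^sup>2))"
  have M: "M summable_on UNIV"
    unfolding M_def by (rule summable_on_int_gaussian) (use assms in auto)
  have term_le: "norm (theta_term 0 0 \<zeta> \<tau> j) \<le> M j" if "\<zeta> \<in> cball \<zeta>\<^sub>0 R" for \<zeta> j
  proof -
    have "\<bar>Im \<zeta> - Im \<zeta>\<^sub>0\<bar> \<le> R"
      using that abs_Im_le_cmod[of "\<zeta> - \<zeta>\<^sub>0"] by (auto simp: dist_norm norm_minus_commute)
    hence "\<bar>Im \<zeta>\<bar> \<le> I" unfolding I_def by linarith
    hence "\<bar>Im \<zeta>\<bar> * \<bar>of_int j\<bar> \<le> I * \<bar>of_int j\<bar>"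
      by (rule mult_right_mono) auto
    moreover have "- (Im \<zeta> * of_int j) \<le> \<bar>Im \<zeta>\<bar> * \<bar>of_int j\<bar>"
      by (metis abs_ge_minus_self abs_mult)
    ultimately have "- (Im \<zeta> * of_int j) \<le> I * \<bar>of_int j\<bar>"
      by linarith
    from mult_left_mono[OF this, of "2 * pi"] show ?thesis
      unfolding norm_theta_term M_def by (simp add: algebra_simps)
  qed
  obtain B where B: "\<And>n k. norm (qbinom x n k) \<le> B"
    using qbinom_bounded[OF x] by blast
  have B0: "B \<ge> 0" using norm_ge_zero[of "qbinom x 0 0"] B[of 0 0] by linarith
  have c_le: "norm (c n j) \<le> B" for n j
    using B B0 by (simp add: c_def)
  have c_lim: "(\<lambda>n. c n j) \<longlonglongrightarrow> 1 / Q" for j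
  proof -
    have "\<forall>\<^sub>F n in sequentially. qbinom x (2 * n) (nat (int n + j)) = c n j"
      using eventually_ge_at_top[of "nat \<bar>j\<bar>"] by eventually_elim (auto simp: c_def)
    thus ?thesis
      using central_qbinom_LIMSEQ[OF x, of j] by (simp add: Q_def tendsto_cong)
  qed
  define d where "d = (\<lambda>n j. norm (c n j - 1 / Q) * M j)"
  have d_le: "\<bar>d n j\<bar> \<le> (B + norm (1 / Q)) * M j" for n j
  proof -
    have "norm (c n j - 1 / Q) \<le> B + norm (1 / Q)"
      using norm_triangle_ineq4[of "c n j" "1 / Q"] c_le[of n j] by linarith
    thus ?thesis unfolding d_def M_def by (simp add: abs_mult mult_right_mono)
  qed
  have d_summable: "d n summable_on UNIV" for n
    using d_le[of n] by (intro summable_on_comparison_test[OF summable_on_cmult_right[OF M]])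
      (auto simp: d_def M_def)
  have d_lim: "(\<lambda>n. \<Sum>\<^sub>\<infinity>j. d n j) \<longlonglongrightarrow> 0"
  proof (rule infsum_dominated_tendsto_0)
    show "(\<lambda>j. (B + norm (1 / Q)) * M j) summable_on UNIV"
      by (rule summable_on_cmult_right[OF M])
    show "(\<lambda>n. d n j) \<longlonglongrightarrow> 0" for j
      unfolding d_def by (intro tendsto_mult_left_zero tendsto_norm_zero)
        (use c_lim[of j] in \<open>simp add: LIM_zero\<close>)
  qed (rule d_le)
  have diff_le: "dist (triple_prod n \<zeta> \<tau>) (theta 0 0 \<zeta> \<tau> / Q) \<le> (\<Sum>\<^sub>\<infinity>j. d n j)"
    if "\<zeta> \<in> cball \<zeta>\<^sub>0 R" for n \<zeta>
  proof -
    have "((\<lambda>j. c n j * theta_term 0 0 \<zeta> \<tau> j) has_sum triple_prod n \<zeta> \<tau>) UNIV"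
      by (rule has_sum_finite_neutralI[of "{- int n..int n}"])
         (auto simp: c_def triple_prod_conv_theta_term[OF assms] x_def)
    moreover have "((\<lambda>j. (- 1 / Q) * theta_term 0 0 \<zeta> \<tau> j) has_sum (- 1 / Q) * theta 0 0 \<zeta> \<tau>) UNIV"
      by (intro has_sum_cmult_right theta_has_sum assms)
    ultimately have "((\<lambda>j. c n j * theta_term 0 0 \<zeta> \<tau> j + (- 1 / Q) * theta_term 0 0 \<zeta> \<tau> j) has_sum
        (triple_prod n \<zeta> \<tau> + (- 1 / Q) * theta 0 0 \<zeta> \<tau>)) UNIV"
      by (rule has_sum_add)
    hence "((\<lambda>j. (c n j - 1 / Q) * theta_term 0 0 \<zeta> \<tau> j) has_sum
        (triple_prod n \<zeta> \<tau> - theta 0 0 \<zeta> \<tau> / Q)) UNIV"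
      by (simp add: algebra_simps)
    moreover have "(d n has_sum (\<Sum>\<^sub>\<infinity>j. d n j)) UNIV"
      using d_summable by (rule has_sum_infsum)
    ultimately show ?thesis
      unfolding dist_norm
      by (rule norm_infsum_le) (auto simp: d_def norm_mult intro!: mult_left_mono term_le[OF that])
  qed
  have "uniform_limit (cball \<zeta>\<^sub>0 R) (\<lambda>n \<zeta>. triple_prod n \<zeta> \<tau>) (\<lambda>\<zeta>. theta 0 0 \<zeta> \<tau> / Q) sequentially"
  proof (rule uniform_limitI)
    fix e :: real assume "e > 0"
    with d_lim have "\<forall>\<^sub>F n in sequentially. dist (\<Sum>\<^sub>\<infinity>j. d n j) 0 < e"
      by (rule tendstoD)
    thus "\<forall>\<^sub>F n in sequentially. \<forall>\<zeta>\<in>cball \<zeta>\<^sub>0 R. dist (triple_prod n \<zeta> \<tau>) (theta 0 0 \<zeta> \<tau> / Q) < e"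
    proof eventually_elim
      case (elim n)
      show ?case
      proof
        fix \<zeta> assume "\<zeta> \<in> cball \<zeta>\<^sub>0 R"
        from diff_le[OF this, of n] elim show "dist (triple_prod n \<zeta> \<tau>) (theta 0 0 \<zeta> \<tau> / Q) < e"
          by simp
      qed
    qed
  qed
  thus ?thesis by (simp add: Q_def x_def)
qed

section \<open>Differentiability and zeros\<close>

lemma jacobi_triple_product:
  assumes "Im \<tau> > 0"
  shows "(\<lambda>n. triple_prod n \<zeta> \<tau>) \<longlonglongrightarrow> theta 0 0 \<zeta> \<tau> / qfact_inf (nome \<tau> ^ 2)"
  using jacobi_triple_product_uniform[OF assms, of \<zeta> 0] by (rule tendsto_uniform_limitI) simp

text \<open>
  Locally uniform limits of holomorphic functions are holomorphic, and the derivatives converge.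
\<close>

lemma triple_prod_deriv_LIMSEQ:
  assumes "Im \<tau> > 0"
  shows "(\<lambda>n. deriv (\<lambda>\<zeta>. triple_prod n \<zeta> \<tau>) \<zeta>) \<longlonglongrightarrow>
           deriv (\<lambda>\<zeta>. theta 0 0 \<zeta> \<tau>) \<zeta> / qfact_inf (nome \<tau> ^ 2)"
    and theta_0_0_field_differentiable: "(\<lambda>\<zeta>. theta 0 0 \<zeta> \<tau>) field_differentiable at \<zeta>"
proof -
  define Q where "Q = qfact_inf (nome \<tau> ^ 2)"
  have Q: "Q \<noteq> 0"
    unfolding Q_def by (rule qfact_inf_nonzero[OF norm_nome_power2_less_1[OF assms]])
  define f where "f = (\<lambda>n \<zeta>. triple_prod n \<zeta> \<tau>)"
  have hol: "f n holomorphic_on UNIV" for n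
    unfolding f_def triple_prod_def by (intro holomorphic_intros)
  have "\<forall>\<^sub>F n in sequentially. continuous_on (cball \<zeta> 1) (f n) \<and>
          (\<forall>w\<in>ball \<zeta> 1. (f n has_field_derivative deriv (f n) w) (at w))"
  proof (intro always_eventually allI conjI ballI)
    show "continuous_on (cball \<zeta> 1) (f n)" for n
      by (rule continuous_on_subset[OF holomorphic_on_imp_continuous_on[OF hol]]) auto
    show "(f n has_field_derivative deriv (f n) w) (at w)" for n w
      by (rule holomorphic_derivI[OF hol]) auto
  qed
  then obtain g' where g': "\<And>w. w \<in> ball \<zeta> 1 \<Longrightarrow>
       ((\<lambda>\<zeta>. theta 0 0 \<zeta> \<tau> / Q) has_field_derivative g' w) (at w) \<and> (\<lambda>n. deriv (f n) w) \<longlonglongrightarrow> g' w"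
    by (rule has_complex_derivative_uniform_limit)
       (use jacobi_triple_product_uniform[OF assms] in \<open>auto simp: f_def Q_def\<close>)
  have 1: "((\<lambda>\<zeta>. theta 0 0 \<zeta> \<tau> / Q) has_field_derivative g' \<zeta>) (at \<zeta>)"
    and 2: "(\<lambda>n. deriv (f n) \<zeta>) \<longlonglongrightarrow> g' \<zeta>"
    using g'[of \<zeta>] by auto
  have 3: "((\<lambda>\<zeta>. theta 0 0 \<zeta> \<tau>) has_field_derivative Q * g' \<zeta>) (at \<zeta>)"
    using DERIV_cmult[OF 1, of Q] Q by simp
  thus "(\<lambda>\<zeta>. theta 0 0 \<zeta> \<tau>) field_differentiable at \<zeta>"
    by (auto simp: field_differentiable_def)
  show "(\<lambda>n. deriv (\<lambda>\<zeta>. triple_prod n \<zeta> \<tau>) \<zeta>) \<longlonglongrightarrow>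
           deriv (\<lambda>\<zeta>. theta 0 0 \<zeta> \<tau>) \<zeta> / qfact_inf (nome \<tau> ^ 2)"
    using 2 Q DERIV_imp_deriv[OF 3] by (simp add: f_def flip: Q_def)
qed

lemma theta_eq_theta_0_0:
  assumes "Im \<tau> > 0"
  shows "theta \<epsilon> \<epsilon>' \<zeta> \<tau> =
    exp (2 * of_real pi * \<i> * (of_real \<epsilon> ^ 2 * \<tau> / 8 + of_real \<epsilon> / 2 * (\<zeta> + of_real \<epsilon>' / 2)))
    * theta 0 0 (\<zeta> + of_real \<epsilon> * \<tau> / 2 + of_real \<epsilon>' / 2) \<tau>"
  using theta_shift[OF assms, of 0 \<epsilon> 0 \<epsilon>' \<zeta>] by simp

lemma theta_0_0_has_field_derivative:
  assumes "Im \<tau> > 0"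
  shows "((\<lambda>\<zeta>. theta 0 0 \<zeta> \<tau>) has_field_derivative deriv (\<lambda>\<zeta>. theta 0 0 \<zeta> \<tau>) \<zeta>) (at \<zeta>)"
  using theta_0_0_field_differentiable[OF assms] by (simp add: field_differentiable_derivI)

lemma theta_has_field_derivative:
  assumes "Im \<tau> > 0"
  shows "((\<lambda>\<zeta>. theta \<epsilon> \<epsilon>' \<zeta> \<tau>) has_field_derivative deriv (\<lambda>\<zeta>. theta \<epsilon> \<epsilon>' \<zeta> \<tau>) \<zeta>) (at \<zeta>)"
proof -
  have "(\<lambda>\<zeta>. theta \<epsilon> \<epsilon>' \<zeta> \<tau>) field_differentiable at \<zeta>"
    unfolding theta_eq_theta_0_0[OF assms, of \<epsilon> \<epsilon>'] field_differentiable_def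
    by (rule exI) (rule derivative_eq_intros refl
      DERIV_chain2[OF theta_0_0_has_field_derivative[OF assms]])+
  thus ?thesis by (simp add: field_differentiable_derivI)
qed

text \<open>
  A convergent infinite product vanishes only if one of its factors does.
\<close>

lemma theta_0_0_nonzero:
  assumes "Im \<tau> > 0"
    and "\<And>i. 1 + exp (2 * of_real pi * \<i> * \<zeta>) * nome \<tau> ^ (1 + 2 * i) \<noteq> 0"
    and "\<And>i. 1 + exp (- (2 * of_real pi * \<i> * \<zeta>)) * nome \<tau> ^ (1 + 2 * i) \<noteq> 0"
  shows "theta 0 0 \<zeta> \<tau> \<noteq> 0"
proof
  assume zero: "theta 0 0 \<zeta> \<tau> = 0"
  let ?f = "\<lambda>z i. 1 + exp z * nome \<tau> ^ (1 + 2 * i)"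
  have conv: "convergent_prod (?f z)" for z
    using convergent_prod_one_plus_power[OF norm_nome_less_1[OF assms(1)], of "exp z" 1 1]
    by (simp add: numeral_2_eq_2)
  have "(\<lambda>n. (\<Prod>i<n. ?f (2 * of_real pi * \<i> * \<zeta>) i) * (\<Prod>i<n. ?f (- (2 * of_real pi * \<i> * \<zeta>)) i))
     \<longlonglongrightarrow> prodinf (?f (2 * of_real pi * \<i> * \<zeta>)) * prodinf (?f (- (2 * of_real pi * \<i> * \<zeta>)))"
    by (intro tendsto_mult prod_LIMSEQ_prodinf conv)
  hence "(\<lambda>n. triple_prod n \<zeta> \<tau>) \<longlonglongrightarrow>
      prodinf (?f (2 * of_real pi * \<i> * \<zeta>)) * prodinf (?f (- (2 * of_real pi * \<i> * \<zeta>)))"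
    by (simp add: triple_prod_def prod.distrib mult_ac)
  moreover have "(\<lambda>n. triple_prod n \<zeta> \<tau>) \<longlonglongrightarrow> 0"
    using jacobi_triple_product[OF assms(1), of \<zeta>] by (simp add: zero)
  ultimately have "prodinf (?f (2 * of_real pi * \<i> * \<zeta>)) * prodinf (?f (- (2 * of_real pi * \<i> * \<zeta>))) = 0"
    by (rule LIMSEQ_unique)
  thus False
    using prodinf_nonzero[OF conv assms(2)] prodinf_nonzero[OF conv assms(3)] by simp
qed

text \<open>
  The zeros of the theta function with characteristics \<open>[0,0]\<close> lie on the lines
  \<open>Im \<zeta> = (k + 1/2) Im \<tau>\<close> with \<open>k\<close> an integer.  For \<open>\<bar>\<epsilon>\<bar> < 1\<close> the argument \<open>(\<epsilon> \<tau> + \<epsilon>')/2\<close> lies strictly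
  between the two lines closest to the real axis.
\<close>

lemma theta_const_nonzero:
  assumes "Im \<tau> > 0" "\<bar>\<epsilon>\<bar> < 1"
  shows "theta_const \<epsilon> \<epsilon>' \<tau> \<noteq> 0"
proof -
  define \<zeta> where "\<zeta> = of_real \<epsilon> * \<tau> / 2 + of_real \<epsilon>' / 2"
  have *: "1 + exp z * nome \<tau> ^ (1 + 2 * i) \<noteq> 0" if "Re z \<le> pi * \<bar>\<epsilon>\<bar> * Im \<tau>" for i z
  proof -
    have "norm (exp z * nome \<tau> ^ (1 + 2 * i)) \<le> exp (Re z) * (norm (nome \<tau>) * 1)"
      unfolding norm_mult norm_power power_add using norm_nome_less_1[OF assms(1)]
      by (intro mult_mono) (auto intro: power_le_one)
    also have "\<dots> = exp (Re z - pi * Im \<tau>)"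
      by (simp add: nome_def flip: exp_add)
    also have "\<dots> < 1"
    proof -
      have "\<bar>\<epsilon>\<bar> * (pi * Im \<tau>) < 1 * (pi * Im \<tau>)"
        using assms by (intro mult_strict_right_mono) auto
      moreover have "pi * \<bar>\<epsilon>\<bar> * Im \<tau> = \<bar>\<epsilon>\<bar> * (pi * Im \<tau>)"
        by simp
      ultimately have "Re z - pi * Im \<tau> < 0"
        using that by linarith
      thus ?thesis by simp
    qed
    finally show ?thesis
      by (metis add_eq_0_iff norm_minus_cancel norm_one order_less_irrefl)
  qed
  have "\<epsilon> * (pi * Im \<tau>) \<le> \<bar>\<epsilon>\<bar> * (pi * Im \<tau>)" "- \<epsilon> * (pi * Im \<tau>) \<le> \<bar>\<epsilon>\<bar> * (pi * Im \<tau>)"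
    by (rule mult_right_mono; use assms in simp)+
  hence "theta 0 0 \<zeta> \<tau> \<noteq> 0"
    by (intro theta_0_0_nonzero[OF assms(1)] *) (auto simp: \<zeta>_def algebra_simps)
  thus ?thesis
    unfolding theta_const_def by (subst theta_eq_theta_0_0[OF assms(1)]) (simp add: \<zeta>_def)
qed

section \<open>Jacobi's derivative formula\<close>

text \<open>
  In the limit this is Euler's identity \<open>\<Prod>(1 + x\<^sup>k) (1 - x\<^bsup>2k-1\<^esup>) = 1\<close> for \<open>x = q\<^sup>2\<close>, since both sides then
  contain the same factor \<open>(x; x)\<^sub>\<infinity>\<close>.  It holds because \<open>1 - x\<^bsup>2k\<^esup>\<close> and \<open>1 - x\<^bsup>2k-1\<^esup>\<close> split into two factors
  each.
\<close>

lemma euler_odd_distinct: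
  "(\<Prod>i<n. 1 + q ^ (2*i+1)) * (\<Prod>i<n. 1 - q ^ (2*i+1)) * (\<Prod>i<n. 1 + (q\<^sup>2) ^ Suc i) * qfact (q\<^sup>2) n
     = qfact (q\<^sup>2) (2 * n)"
proof (induction n)
  case (Suc n)
  have "qfact (q\<^sup>2) (2 * Suc n) = qfact (q\<^sup>2) (2 * n) * ((1 - (q\<^sup>2) ^ (2 * n + 1)) * (1 - (q\<^sup>2) ^ (2 * n + 2)))"
    by (simp add: qfact_def)
  also have "1 - (q\<^sup>2) ^ (2 * n + 1) = (1 + q ^ (2*n+1)) * (1 - q ^ (2*n+1))"
    by (simp add: power_mult power2_eq_square algebra_simps flip: power_mult_distrib)
  also have "1 - (q\<^sup>2) ^ (2 * n + 2) = (1 + (q\<^sup>2) ^ Suc n) * (1 - (q\<^sup>2) ^ Suc n)"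
    by (simp add: power_mult power2_eq_square algebra_simps flip: power_mult_distrib)
  finally show ?case
    unfolding Suc.IH[symmetric] by (simp add: qfact_def)
qed (simp add: qfact_def)

text \<open>
  At \<open>\<zeta> = (\<tau> + 1)/2\<close> the factor \<open>1 + q exp(-2\<pi>\<i>\<zeta>)\<close> vanishes, so only its own derivative contributes.
\<close>

lemma triple_prod_Suc_deriv:
  fixes \<tau> :: complex
  defines "\<zeta>\<^sub>0 \<equiv> \<tau> / 2 + 1 / 2" and "x \<equiv> nome \<tau> ^ 2"
  shows "((\<lambda>\<zeta>. triple_prod (Suc n) \<zeta> \<tau>) has_field_derivative
            2 * of_real pi * \<i> * (qfact x (Suc n) * qfact x n)) (at \<zeta>\<^sub>0)"
proof -
  define q where "q = nome \<tau>"
  have q: "q \<noteq> 0" by (simp add: q_def)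
  define B where "B = (\<lambda>\<zeta>. (1 + q * exp (2 * of_real pi * \<i> * \<zeta>)) *
      (\<Prod>i<n. (1 + q ^ (2 * Suc i + 1) * exp (2 * of_real pi * \<i> * \<zeta>)) *
               (1 + q ^ (2 * Suc i + 1) * exp (- (2 * of_real pi * \<i> * \<zeta>)))))"
  have e: "exp (2 * of_real pi * \<i> * \<zeta>\<^sub>0) = - q"
    by (simp add: \<zeta>\<^sub>0_def q_def nome_def algebra_simps exp_add)
  have e': "exp (- (2 * of_real pi * \<i> * \<zeta>\<^sub>0)) = - (1 / q)"
    unfolding exp_minus e by (simp add: field_simps)
  have eq: "triple_prod (Suc n) \<zeta> \<tau> = (1 + q * exp (- (2 * of_real pi * \<i> * \<zeta>))) * B \<zeta>" for \<zeta>
    unfolding triple_prod_def B_def q_def by (subst prod.lessThan_Suc_shift) (simp add: mult_ac)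
  have "B holomorphic_on UNIV"
    unfolding B_def by (intro holomorphic_intros)
  hence B: "(B has_field_derivative deriv B \<zeta>\<^sub>0) (at \<zeta>\<^sub>0)"
    by (rule holomorphic_derivI) auto
  have "((\<lambda>\<zeta>. (1 + q * exp (- (2 * of_real pi * \<i> * \<zeta>))) * B \<zeta>) has_field_derivative
          2 * of_real pi * \<i> * B \<zeta>\<^sub>0) (at \<zeta>\<^sub>0)"
    by (rule derivative_eq_intros B refl)+ (use q in \<open>simp add: e'\<close>)
  moreover have "B \<zeta>\<^sub>0 = qfact x (Suc n) * qfact x n"
  proof -
    have "B \<zeta>\<^sub>0 = (1 - x) * (\<Prod>i<n. (1 - x ^ Suc (Suc i)) * (1 - x ^ Suc i))"
      unfolding B_def e e' x_def q_def[symmetric] power_mult[symmetric] using q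
      by (intro arg_cong2[of _ _ _ _ "(*)"] prod.cong refl) (simp_all add: power2_eq_square)
    also have "\<dots> = (\<Prod>i<Suc n. 1 - x ^ Suc i) * (\<Prod>i<n. 1 - x ^ Suc i)"
      by (subst prod.lessThan_Suc_shift) (simp add: prod.distrib mult_ac)
    finally show ?thesis by (simp add: qfact_def)
  qed
  ultimately show ?thesis by (simp add: eq[abs_def])
qed

text \<open>
  By the triple product, with \<open>q = exp(\<pi>\<i>\<tau>)\<close> and \<open>Q = \<Prod>(1 - q\<^bsup>2k\<^esup>)\<close>, the values \<open>\<theta>\<^sub>3(0)\<close>, \<open>\<theta>\<^sub>4(0)\<close>, \<open>\<theta>\<^sub>2(0)\<close> are
  \<open>Q P\<^sup>2\<close>, \<open>Q M\<^sup>2\<close>, \<open>2 r Q E\<^sup>2\<close>, where \<open>P, M, E\<close> are the products of \<open>1 + q\<^bsup>2k-1\<^esup>\<close>, \<open>1 - q\<^bsup>2k-1\<^esup>\<close>, \<open>1 + q\<^bsup>2k\<^esup>\<close> and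
  \<open>r = exp(\<pi>\<i>\<tau>/4)\<close>.  Moreover \<open>\<theta>\<^sub>1'(0) = -2\<pi> r Q\<^sup>3\<close>, and \<open>P M E = 1\<close> by Euler's identity.  The value of \<open>\<theta>\<^sub>2\<close>
  is treated separately from \<open>theta_const_nonzero\<close>, as \<open>\<tau>/2\<close> is on a line that contains zeros.
\<close>

theorem jacobi_derivative_formula:
  assumes "Im \<tau> > 0"
  shows theta_deriv_1_1_eq: "theta_deriv 1 1 \<tau> = - of_real pi * theta_const 0 0 \<tau> * theta_const 1 0 \<tau> * theta_const 0 1 \<tau>"
    and theta_const_1_0_nonzero: "theta_const 1 0 \<tau> \<noteq> 0"
proof -
  define q x where "q = nome \<tau>" and "x = q ^ 2"
  define Q where "Q = qfact_inf x"
  define r where "r = exp (2 * of_real pi * \<i> * (\<tau> / 8))"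
  have q: "norm q < 1" and x: "norm x < 1"
    using norm_nome_less_1[OF assms] norm_nome_power2_less_1[OF assms] by (simp_all add: q_def x_def)
  have Q0: "Q \<noteq> 0" and Qlim: "qfact x \<longlonglongrightarrow> Q"
    using qfact_LIMSEQ[OF x] qfact_inf_nonzero[OF x] by (simp_all add: Q_def)
  have T: "(\<lambda>n. triple_prod n \<zeta> \<tau>) \<longlonglongrightarrow> theta 0 0 \<zeta> \<tau> / Q" for \<zeta>
    using jacobi_triple_product[OF assms] by (simp add: Q_def x_def q_def)
  define P where "P = (\<Prod>i. 1 + q ^ (2*i+1))"
  define M where "M = (\<Prod>i. 1 - q ^ (2*i+1))"
  define E where "E = (\<Prod>i. 1 + x ^ Suc i)"
  have P: "(\<lambda>n. \<Prod>i<n. 1 + q ^ (2*i+1)) \<longlonglongrightarrow> P"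
    unfolding P_def using convergent_prod_one_plus_power[OF q, of 1 1 1]
    by (intro prod_LIMSEQ_prodinf) (simp add: numeral_2_eq_2)
  have M: "(\<lambda>n. \<Prod>i<n. 1 - q ^ (2*i+1)) \<longlonglongrightarrow> M"
    unfolding M_def using convergent_prod_one_plus_power[OF q, of "-1" 1 1]
    by (intro prod_LIMSEQ_prodinf) (simp add: numeral_2_eq_2)
  have conv_E: "convergent_prod (\<lambda>i. 1 + x ^ Suc i)"
    using convergent_prod_one_plus_power[OF x, of 1 1 0] by simp
  hence E: "(\<lambda>n. \<Prod>i<n. 1 + x ^ Suc i) \<longlonglongrightarrow> E"
    unfolding E_def by (rule prod_LIMSEQ_prodinf)
  have E0: "E \<noteq> 0"
    unfolding E_def by (rule prodinf_nonzero[OF conv_E one_plus_power_neq_0(1)[OF x]])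

  have PME: "P * M * E = 1"
  proof -
    have "(\<lambda>n. (\<Prod>i<n. 1 + q ^ (2*i+1)) * (\<Prod>i<n. 1 - q ^ (2*i+1)) * (\<Prod>i<n. 1 + x ^ Suc i) * qfact x n)
       \<longlonglongrightarrow> P * M * E * Q"
      by (intro tendsto_mult P M E Qlim)
    hence "(\<lambda>n. qfact x (2 * n)) \<longlonglongrightarrow> P * M * E * Q"
      unfolding x_def euler_odd_distinct .
    moreover have "(\<lambda>n. qfact x (2 * n)) \<longlonglongrightarrow> Q"
      by (rule filterlim_compose[OF Qlim]) (auto intro!: mult_nat_left_at_top)
    ultimately have "P * M * E * Q = Q"
      by (rule LIMSEQ_unique)
    thus ?thesis using Q0 by simp
  qed

  have "(\<lambda>n. triple_prod n 0 \<tau>) \<longlonglongrightarrow> P * P"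
    using tendsto_mult[OF P P] by (simp add: triple_prod_def prod.distrib q_def)
  from LIMSEQ_unique[OF T this] have theta3: "theta_const 0 0 \<tau> = Q * P ^ 2"
    using Q0 by (simp add: theta_const_def field_simps power2_eq_square)

  have "(\<lambda>n. triple_prod n (1 / 2) \<tau>) \<longlonglongrightarrow> M * M"
    using tendsto_mult[OF M M] by (simp add: triple_prod_def prod.distrib q_def exp_minus)
  from LIMSEQ_unique[OF T this] have theta4: "theta_const 0 1 \<tau> = Q * M ^ 2"
    using Q0 theta_eq_theta_0_0[OF assms, of 0 1 0]
    by (simp add: theta_const_def field_simps power2_eq_square)

  have "theta 0 0 (\<tau> / 2) \<tau> = Q * (2 * E ^ 2)"
  proof -
    have e: "exp (2 * of_real pi * \<i> * (\<tau> / 2)) = q" "exp (- (2 * of_real pi * \<i> * (\<tau> / 2))) = 1 / q"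
      by (simp_all add: q_def nome_def exp_minus field_simps)
    have "triple_prod (Suc n) (\<tau> / 2) \<tau> = (\<Prod>i<Suc n. 1 + x ^ Suc i) * (2 * (\<Prod>i<n. 1 + x ^ Suc i))" for n
    proof -
      have "triple_prod (Suc n) (\<tau> / 2) \<tau> = (\<Prod>i<Suc n. (1 + x ^ Suc i) * (1 + x ^ i))"
        unfolding triple_prod_def e q_def[symmetric] x_def power_mult[symmetric]
        by (intro prod.cong refl) (simp add: q_def power2_eq_square mult_ac)
      also have "\<dots> = (\<Prod>i<Suc n. 1 + x ^ Suc i) * (\<Prod>i<Suc n. 1 + x ^ i)"
        by (rule prod.distrib)
      also have "(\<Prod>i<Suc n. 1 + x ^ i) = 2 * (\<Prod>i<n. 1 + x ^ Suc i)"
        by (subst prod.lessThan_Suc_shift) simp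
      finally show ?thesis .
    qed
    moreover have "(\<lambda>n. (\<Prod>i<Suc n. 1 + x ^ Suc i) * (2 * (\<Prod>i<n. 1 + x ^ Suc i))) \<longlonglongrightarrow> E * (2 * E)"
      by (intro tendsto_mult tendsto_const E LIMSEQ_Suc[OF E])
    ultimately have "(\<lambda>n. triple_prod (Suc n) (\<tau> / 2) \<tau>) \<longlonglongrightarrow> E * (2 * E)"
      by simp
    from LIMSEQ_unique[OF LIMSEQ_Suc[OF T] this] show ?thesis
      using Q0 by (simp add: field_simps power2_eq_square)
  qed
  hence theta2: "theta_const 1 0 \<tau> = 2 * r * Q * E ^ 2"
    using theta_eq_theta_0_0[OF assms, of 1 0 0] by (simp add: theta_const_def r_def)
  show "theta_const 1 0 \<tau> \<noteq> 0"
    using Q0 E0 by (simp add: theta2 r_def)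

  define \<zeta>\<^sub>0 where "\<zeta>\<^sub>0 = \<tau> / 2 + 1 / 2"
  have deriv_00: "deriv (\<lambda>\<zeta>. theta 0 0 \<zeta> \<tau>) \<zeta>\<^sub>0 = 2 * of_real pi * \<i> * Q ^ 3"
  proof -
    have "(\<lambda>n. deriv (\<lambda>\<zeta>. triple_prod (Suc n) \<zeta> \<tau>) \<zeta>\<^sub>0) \<longlonglongrightarrow> deriv (\<lambda>\<zeta>. theta 0 0 \<zeta> \<tau>) \<zeta>\<^sub>0 / Q"
      using LIMSEQ_Suc[OF triple_prod_deriv_LIMSEQ(1)[OF assms, of \<zeta>\<^sub>0]] by (simp add: Q_def x_def q_def)
    moreover have "deriv (\<lambda>\<zeta>. triple_prod (Suc n) \<zeta> \<tau>) \<zeta>\<^sub>0 = 2 * of_real pi * \<i> * (qfact x (Suc n) * qfact x n)" for n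
      unfolding \<zeta>\<^sub>0_def x_def q_def by (rule DERIV_imp_deriv[OF triple_prod_Suc_deriv])
    moreover have "(\<lambda>n. 2 * of_real pi * \<i> * (qfact x (Suc n) * qfact x n)) \<longlonglongrightarrow> 2 * of_real pi * \<i> * (Q * Q)"
      by (intro tendsto_mult tendsto_const Qlim LIMSEQ_Suc[OF Qlim])
    ultimately have "deriv (\<lambda>\<zeta>. theta 0 0 \<zeta> \<tau>) \<zeta>\<^sub>0 / Q = 2 * of_real pi * \<i> * (Q * Q)"
      by (simp add: LIMSEQ_unique)
    thus ?thesis using Q0 by (simp add: field_simps power3_eq_cube)
  qed
  have zero: "theta 0 0 \<zeta>\<^sub>0 \<tau> = 0"
    using theta_eq_theta_0_0[OF assms, of 1 1 0] theta_1_1_0[OF assms] by (simp add: \<zeta>\<^sub>0_def)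
  have "((\<lambda>\<zeta>. theta 0 0 (\<zeta> + \<zeta>\<^sub>0) \<tau>) has_field_derivative deriv (\<lambda>\<zeta>. theta 0 0 \<zeta> \<tau>) (0 + \<zeta>\<^sub>0)) (at 0)"
    using theta_0_0_has_field_derivative[OF assms, of "0 + \<zeta>\<^sub>0"] by (subst (asm) DERIV_shift)
  hence d: "((\<lambda>\<zeta>. theta 0 0 (\<zeta> + \<zeta>\<^sub>0) \<tau>) has_field_derivative 2 * of_real pi * \<i> * Q ^ 3) (at 0)"
    by (simp add: deriv_00)
  define g where "g = (\<lambda>\<zeta>. exp (2 * of_real pi * \<i> * (\<tau> / 8 + 1 / 2 * (\<zeta> + 1 / 2))))"
  have "g 0 = r * exp (\<i> * of_real (pi / 2))"
    unfolding g_def r_def mult_exp_exp by (intro arg_cong[of _ _ exp]) (simp add: field_simps)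
  hence g0: "g 0 = r * \<i>"
    using cis_pi_half by (simp only: cis_conv_exp)
  have "g holomorphic_on UNIV"
    unfolding g_def by (intro holomorphic_intros)
  hence "(g has_field_derivative deriv g 0) (at 0)"
    by (rule holomorphic_derivI) auto
  from DERIV_mult[OF this d]
  have "((\<lambda>\<zeta>. g \<zeta> * theta 0 0 (\<zeta> + \<zeta>\<^sub>0) \<tau>)
      has_field_derivative (r * \<i>) * (2 * of_real pi * \<i> * Q ^ 3)) (at 0)"
    by (simp add: zero g0 mult_ac)
  also have "(\<lambda>\<zeta>. g \<zeta> * theta 0 0 (\<zeta> + \<zeta>\<^sub>0) \<tau>)
       = (\<lambda>\<zeta>. theta 1 1 \<zeta> \<tau>)"
    by (rule ext) (subst theta_eq_theta_0_0[OF assms, of 1 1], simp add: \<zeta>\<^sub>0_def g_def add.assoc)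
  finally have "theta_deriv 1 1 \<tau> = (r * \<i>) * (2 * of_real pi * \<i> * Q ^ 3)"
    unfolding theta_deriv_def by (rule DERIV_imp_deriv)
  also have "\<dots> = - of_real pi * (2 * r * Q ^ 3) * (P * M * E) ^ 2"
    unfolding PME by (simp add: mult_ac)
  also have "\<dots> = - of_real pi * (Q * P ^ 2) * (2 * r * Q * E ^ 2) * (Q * M ^ 2)"
    by (simp add: power_mult_distrib power3_eq_cube)
  also have "\<dots> = - of_real pi * theta_const 0 0 \<tau> * theta_const 1 0 \<tau> * theta_const 0 1 \<tau>"
    unfolding theta2 theta3 theta4 ..
  finally show "theta_deriv 1 1 \<tau> = - of_real pi * theta_const 0 0 \<tau> * theta_const 1 0 \<tau> * theta_const 0 1 \<tau>" .
qed

section \<open>Products of two theta functions\<close>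

lemma has_sum_product:
  fixes f :: "'a \<Rightarrow> complex" and g :: "'b \<Rightarrow> complex"
  assumes "(\<lambda>x. norm (f x)) summable_on UNIV" "(\<lambda>y. norm (g y)) summable_on UNIV"
    and f: "(f has_sum S) UNIV" and g: "(g has_sum T) UNIV"
  shows "((\<lambda>(x, y). f x * g y) has_sum S * T) UNIV"
proof -
  have "((\<lambda>(x, y). f x * g y) has_sum S * T) (Sigma UNIV (\<lambda>_. UNIV))"
  proof (rule has_sum_SigmaI)
    show "((\<lambda>y. case (x, y) of (x, y) \<Rightarrow> f x * g y) has_sum f x * T) UNIV" for x
      using has_sum_cmult_right[OF g] by simp
    show "((\<lambda>x. f x * T) has_sum S * T) UNIV"
      by (rule has_sum_cmult_left[OF f])
    have "(\<lambda>(x, y). norm (f x) * norm (g y)) summable_on (Sigma UNIV (\<lambda>_. UNIV))"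
    proof (rule summable_on_SigmaI)
      show "((\<lambda>y. case (x, y) of (x, y) \<Rightarrow> norm (f x) * norm (g y)) has_sum norm (f x) * (\<Sum>\<^sub>\<infinity>y. norm (g y))) UNIV" for x
        using has_sum_cmult_right[OF has_sum_infsum[OF assms(2)]] by simp
      show "(\<lambda>x. norm (f x) * (\<Sum>\<^sub>\<infinity>y. norm (g y))) summable_on UNIV"
        by (rule summable_on_cmult_left[OF assms(1)])
    qed auto
    hence "(\<lambda>p. norm (case p of (x, y) \<Rightarrow> f x * g y)) summable_on (Sigma UNIV (\<lambda>_. UNIV))"
      by (simp add: case_prod_unfold norm_mult)
    thus "(\<lambda>(x, y). f x * g y) summable_on (Sigma UNIV (\<lambda>_. UNIV))"
      by (rule abs_summable_summable)
  qed
  thus ?thesis by simp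
qed

text \<open>
  The quadratic forms satisfy \<open>a\<^sup>2 + b\<^sup>2 = ((a + b)\<^sup>2 + (a - b)\<^sup>2)/2\<close>.  The sum and the difference of the
  two summation indices have the same parity \<open>\<nu>\<close>, namely \<open>2 k + \<nu>\<close> and \<open>2 l + \<nu>\<close>.
\<close>

lemma theta_term_mult:
  "theta_term \<epsilon> \<epsilon>' (x + y) \<tau> (k + l + \<nu>) * theta_term \<delta> \<delta>' (x - y) \<tau> (k - l) =
   theta_term ((\<epsilon> + \<delta>) / 2 + of_int \<nu>) (\<epsilon>' + \<delta>') (2 * x) (2 * \<tau>) k *
   theta_term ((\<epsilon> - \<delta>) / 2 + of_int \<nu>) (\<epsilon>' - \<delta>') (2 * y) (2 * \<tau>) l"
  unfolding theta_term_def mult_exp_exp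
  by (intro arg_cong[of _ _ exp]) (simp add: field_simps power2_eq_square)

text \<open>
  The pairs \<open>(m, n)\<close> split by the parity of \<open>m + n\<close>; on each class \<open>(m + n, m - n)\<close> runs over all pairs
  of integers of that parity, and the double series factors.
\<close>

theorem theta_product_formula:
  assumes "Im \<tau> > 0"
  shows "theta \<epsilon> \<epsilon>' (x + y) \<tau> * theta \<delta> \<delta>' (x - y) \<tau> =
     theta ((\<epsilon> + \<delta>) / 2) (\<epsilon>' + \<delta>') (2 * x) (2 * \<tau>) * theta ((\<epsilon> - \<delta>) / 2) (\<epsilon>' - \<delta>') (2 * y) (2 * \<tau>) +
     theta ((\<epsilon> + \<delta>) / 2 + 1) (\<epsilon>' + \<delta>') (2 * x) (2 * \<tau>) *
       theta ((\<epsilon> - \<delta>) / 2 + 1) (\<epsilon>' - \<delta>') (2 * y) (2 * \<tau>)"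
proof -
  define P where "P = (\<lambda>(m, n). theta_term \<epsilon> \<epsilon>' (x + y) \<tau> m * theta_term \<delta> \<delta>' (x - y) \<tau> n)"
  define S where "S = (\<lambda>\<nu>::int. {(m, n). even (m + n - \<nu>)})"
  have product: "((\<lambda>(m, n). theta_term \<alpha> \<alpha>' \<xi> \<sigma> m * theta_term \<beta> \<beta>' \<eta> \<sigma> n) has_sum
      theta \<alpha> \<alpha>' \<xi> \<sigma> * theta \<beta> \<beta>' \<eta> \<sigma>) UNIV" if "Im \<sigma> > 0" for \<alpha> \<alpha>' \<xi> \<sigma> \<beta> \<beta>' \<eta>
    by (rule has_sum_product) (simp_all add: abs_summable_theta_term theta_has_sum that)
  have P_sum: "(P has_sum theta ((\<epsilon> + \<delta>) / 2 + of_int \<nu>) (\<epsilon>' + \<delta>') (2 * x) (2 * \<tau>) *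
       theta ((\<epsilon> - \<delta>) / 2 + of_int \<nu>) (\<epsilon>' - \<delta>') (2 * y) (2 * \<tau>)) (S \<nu>)" for \<nu> :: int
  proof -
    have "((\<lambda>(k, l). theta_term ((\<epsilon> + \<delta>) / 2 + of_int \<nu>) (\<epsilon>' + \<delta>') (2 * x) (2 * \<tau>) k *
       theta_term ((\<epsilon> - \<delta>) / 2 + of_int \<nu>) (\<epsilon>' - \<delta>') (2 * y) (2 * \<tau>) l) has_sum
       theta ((\<epsilon> + \<delta>) / 2 + of_int \<nu>) (\<epsilon>' + \<delta>') (2 * x) (2 * \<tau>) *
       theta ((\<epsilon> - \<delta>) / 2 + of_int \<nu>) (\<epsilon>' - \<delta>') (2 * y) (2 * \<tau>)) UNIV"
      by (rule product) (use assms in simp)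
    also have "?this \<longleftrightarrow> ?thesis"
    proof (rule has_sum_reindex_bij_witness[of _
        "\<lambda>(m, n). ((m + n - \<nu>) div 2, (m - n - \<nu>) div 2)" "\<lambda>(k, l). (k + l + \<nu>, k - l)"])
      fix p :: "int \<times> int" assume "p \<in> S \<nu>"
      moreover obtain m n where p: "p = (m, n)" by force
      ultimately have "even (m + n - \<nu>)" by (simp add: S_def)
      then obtain a where a: "m + n - \<nu> = 2 * a" by (elim evenE)
      hence a': "m - n - \<nu> = 2 * (a - n)" by simp
      thus "(case case p of (m, n) \<Rightarrow> ((m + n - \<nu>) div 2, (m - n - \<nu>) div 2) of
              (k, l) \<Rightarrow> (k + l + \<nu>, k - l)) = p"
        unfolding p prod.case a a' using a by simp
    qed (auto simp: S_def P_def theta_term_mult)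
    finally show ?thesis .
  qed
  have "S 0 \<inter> S 1 = {}" "S 0 \<union> S 1 = UNIV"
    by (auto simp: S_def)
  hence "(P has_sum
     theta ((\<epsilon> + \<delta>) / 2) (\<epsilon>' + \<delta>') (2 * x) (2 * \<tau>) * theta ((\<epsilon> - \<delta>) / 2) (\<epsilon>' - \<delta>') (2 * y) (2 * \<tau>) +
     theta ((\<epsilon> + \<delta>) / 2 + 1) (\<epsilon>' + \<delta>') (2 * x) (2 * \<tau>) *
       theta ((\<epsilon> - \<delta>) / 2 + 1) (\<epsilon>' - \<delta>') (2 * y) (2 * \<tau>)) UNIV"
    using has_sum_Un_disjoint[OF P_sum[of 0] P_sum[of 1]] by simp
  moreover have "(P has_sum theta \<epsilon> \<epsilon>' (x + y) \<tau> * theta \<delta> \<delta>' (x - y) \<tau>) UNIV"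
    unfolding P_def by (rule product[OF assms])
  ultimately show ?thesis by (rule has_sum_unique[symmetric])
qed

text \<open>
  Differences appear because raising the second characteristic by \<open>2\<close> multiplies by \<open>exp(\<pi>\<i>\<epsilon>)\<close>.  The
  characteristic \<open>[3/2,0]\<close> is the reflection of \<open>[1/2,0]\<close>, hence the negated arguments.
\<close>

lemma theta_products:
  assumes "Im \<tau> > 0"
  shows theta4_theta4: "theta 0 1 (x + y) \<tau> * theta 0 1 (x - y) \<tau> =
      theta 0 0 (2 * x) (2 * \<tau>) * theta 0 0 (2 * y) (2 * \<tau>) -
      theta 1 0 (2 * x) (2 * \<tau>) * theta 1 0 (2 * y) (2 * \<tau>)"
    and theta1_theta1: "theta 1 1 (x + y) \<tau> * theta 1 1 (x - y) \<tau> =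
      theta 0 0 (2 * x) (2 * \<tau>) * theta 1 0 (2 * y) (2 * \<tau>) -
      theta 1 0 (2 * x) (2 * \<tau>) * theta 0 0 (2 * y) (2 * \<tau>)"
    and theta1_theta4: "theta 1 1 (x + y) \<tau> * theta 0 1 (x - y) \<tau> =
      \<i> * (theta (1/2) 0 (2 * x) (2 * \<tau>) * theta (1/2) 0 (2 * y) (2 * \<tau>) -
           theta (1/2) 0 (- (2 * x)) (2 * \<tau>) * theta (1/2) 0 (- (2 * y)) (2 * \<tau>))"
    and theta2_theta3: "theta 1 0 (x + y) \<tau> * theta 0 0 (x - y) \<tau> =
      theta (1/2) 0 (2 * x) (2 * \<tau>) * theta (1/2) 0 (2 * y) (2 * \<tau>) +
      theta (1/2) 0 (- (2 * x)) (2 * \<tau>) * theta (1/2) 0 (- (2 * y)) (2 * \<tau>)"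
proof -
  have \<tau>2: "Im (2 * \<tau>) > 0" using assms by simp
  have i: "exp (of_real pi * \<i> / 2) = \<i>"
    using cis_pi_half by (simp add: cis_conv_exp mult_ac)
  have i2: "exp (of_real pi * \<i> * 2) = 1"
    using exp_two_pi_i by (simp add: mult_ac)
  have "of_real pi * (\<i> * 3) / 2 = of_real pi * \<i> + of_real pi * \<i> / 2"
    by simp
  hence i3: "exp (of_real pi * (\<i> * 3) / 2) = - \<i>"
    by (simp only: exp_add i) simp
  have reflect: "theta (3/2) 0 z (2 * \<tau>) = theta (1/2) 0 (- z) (2 * \<tau>)" for z
    using theta_add_2_left[OF \<tau>2, of "-1/2" 0 z] theta_uminus[OF \<tau>2, of "1/2" 0 "- z"] by simp
  note period = theta_add_2_right[OF \<tau>2, of _ 0, simplified] theta_add_2_left[OF \<tau>2, of 0, simplified]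
  note prod = theta_product_formula[OF assms, of _ _ x y]
  show "theta 0 1 (x + y) \<tau> * theta 0 1 (x - y) \<tau> =
      theta 0 0 (2 * x) (2 * \<tau>) * theta 0 0 (2 * y) (2 * \<tau>) -
      theta 1 0 (2 * x) (2 * \<tau>) * theta 1 0 (2 * y) (2 * \<tau>)"
    using prod[of 0 1 0 1] by (simp add: period)
  show "theta 1 1 (x + y) \<tau> * theta 1 1 (x - y) \<tau> =
      theta 0 0 (2 * x) (2 * \<tau>) * theta 1 0 (2 * y) (2 * \<tau>) -
      theta 1 0 (2 * x) (2 * \<tau>) * theta 0 0 (2 * y) (2 * \<tau>)"
    using prod[of 1 1 1 1] by (simp add: period i2)
  show "theta 1 1 (x + y) \<tau> * theta 0 1 (x - y) \<tau> =
      \<i> * (theta (1/2) 0 (2 * x) (2 * \<tau>) * theta (1/2) 0 (2 * y) (2 * \<tau>) -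
           theta (1/2) 0 (- (2 * x)) (2 * \<tau>) * theta (1/2) 0 (- (2 * y)) (2 * \<tau>))"
    using prod[of 1 1 0 1] by (simp add: period reflect i i3 right_diff_distrib mult.assoc)
  show "theta 1 0 (x + y) \<tau> * theta 0 0 (x - y) \<tau> =
      theta (1/2) 0 (2 * x) (2 * \<tau>) * theta (1/2) 0 (2 * y) (2 * \<tau>) +
      theta (1/2) 0 (- (2 * x)) (2 * \<tau>) * theta (1/2) 0 (- (2 * y)) (2 * \<tau>)"
    using prod[of 1 0 0 0] by (simp add: reflect)
qed

section \<open>Logarithmic derivatives\<close>

lemma has_field_derivative_product_add_diff:
  fixes f g :: "complex \<Rightarrow> complex"
  assumes f: "(f has_field_derivative f') (at (x + y))" and g: "(g has_field_derivative g') (at (x - y))"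
  shows "((\<lambda>t. f (x + t) * g (x - t)) has_field_derivative f' * g (x - y) - f (x + y) * g') (at y)"
proof -
  have "((\<lambda>t. x + t) has_field_derivative 1) (at y)"
    by (rule derivative_eq_intros refl)+ simp
  from DERIV_chain2[OF f this] have 1: "((\<lambda>t. f (x + t)) has_field_derivative f') (at y)"
    by simp
  have "((\<lambda>t. x - t) has_field_derivative - 1) (at y)"
    by (rule derivative_eq_intros refl)+ simp
  from DERIV_chain2[OF g this] have 2: "((\<lambda>t. g (x - t)) has_field_derivative - g') (at y)"
    by simp
  show ?thesis
    using DERIV_mult[OF 1 2] by (simp add: algebra_simps)
qed

text \<open>
  By \<open>theta_products\<close>, with one function \<open>C\<close>, both \<open>\<theta>\<^sub>1(x + y) \<theta>\<^sub>4(x - y) / \<i>\<close> and \<open>\<theta>\<^sub>2(x + y) \<theta>\<^sub>3(x - y)\<close> have the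
  form \<open>C(2x) C(2y) \<mp> C(-2x) C(-2y)\<close>.  At \<open>y = 0\<close> the \<open>y\<close>-derivative of the first, which is the
  Wronskian, and the value of the second are constants times the same function \<open>C(2x) + C(-2x)\<close>.
  The constants are compared at \<open>x = 0\<close>.
\<close>

theorem theta1_theta4_wronskian:
  assumes "Im \<tau> > 0"
  defines "D \<equiv> \<lambda>\<epsilon> \<epsilon>' z. deriv (\<lambda>\<zeta>. theta \<epsilon> \<epsilon>' \<zeta> \<tau>) z"
  shows "(D 1 1 x * theta 0 1 x \<tau> - theta 1 1 x \<tau> * D 0 1 x) * (theta 1 0 0 \<tau> * theta 0 0 0 \<tau>) =
         D 1 1 0 * theta 0 1 0 \<tau> * (theta 1 0 x \<tau> * theta 0 0 x \<tau>)"
proof -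
  have \<tau>2: "Im (2 * \<tau>) > 0" using assms by simp
  have d: "((\<lambda>\<zeta>. theta \<epsilon> \<epsilon>' \<zeta> \<tau>) has_field_derivative D \<epsilon> \<epsilon>' \<zeta>) (at \<zeta>)" for \<epsilon> \<epsilon>' \<zeta>
    unfolding D_def by (rule theta_has_field_derivative[OF assms(1)])
  define C where "C = (\<lambda>z. theta (1/2) 0 z (2 * \<tau>))"
  define C' where "C' = deriv C 0"
  have dC: "(C has_field_derivative C') (at 0)"
    unfolding C'_def C_def by (rule theta_has_field_derivative[OF \<tau>2])
  have W: "D 1 1 x * theta 0 1 x \<tau> - theta 1 1 x \<tau> * D 0 1 x = 2 * \<i> * C' * (C (2 * x) + C (- (2 * x)))" for x
  proof -
    have "((\<lambda>y. theta 1 1 (x + y) \<tau> * theta 0 1 (x - y) \<tau>) has_field_derivative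
       D 1 1 x * theta 0 1 x \<tau> - theta 1 1 x \<tau> * D 0 1 x) (at 0)"
      using has_field_derivative_product_add_diff[OF d[of 1 1] d[of 0 1], where x = x and y = 0] by simp
    moreover have "((\<lambda>y. \<i> * (C (2 * x) * C (2 * y) - C (- (2 * x)) * C (- (2 * y)))) has_field_derivative
       2 * \<i> * C' * (C (2 * x) + C (- (2 * x)))) (at 0)"
    proof -
      have linear: "((\<lambda>y. k * y) has_field_derivative k) (at 0)" for k :: complex
        by (rule DERIV_cmult_Id)
      have 1: "((\<lambda>y. C (2 * y)) has_field_derivative C' * 2) (at 0)"
        using DERIV_chain2[of C C' "\<lambda>y. 2 * y" 0 2 UNIV, OF _ linear] dC by simp
      have 2: "((\<lambda>y. C (- (2 * y))) has_field_derivative C' * (- 2)) (at 0)"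
        using DERIV_chain2[of C C' "\<lambda>y. - 2 * y" 0 "- 2" UNIV, OF _ linear] dC by simp
      show ?thesis
        using DERIV_cmult[OF DERIV_diff[OF DERIV_cmult[OF 1, of "C (2 * x)"]
          DERIV_cmult[OF 2, of "C (- (2 * x))"]], of \<i>] by (simp add: algebra_simps)
    qed
    ultimately show ?thesis
      unfolding theta1_theta4[OF assms(1)] C_def by (rule DERIV_unique)
  qed
  have T: "theta 1 0 x \<tau> * theta 0 0 x \<tau> = C 0 * (C (2 * x) + C (- (2 * x)))" for x
    using theta2_theta3[OF assms(1), of x 0] by (simp add: C_def algebra_simps)
  have "D 1 1 0 * theta 0 1 0 \<tau> = 2 * \<i> * C' * (2 * C 0)"
    using W[of 0] by (simp add: theta_1_1_0[OF assms(1)])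
  thus ?thesis
    unfolding W T by simp
qed

text \<open>
  Let \<open>A, B\<close> be the two functions that occur in \<open>theta4_theta4\<close> and \<open>theta1_theta1\<close>.  Then
  \<open>\<theta>\<^sub>4(x)\<^sup>2\<close>, \<open>\<theta>\<^sub>1(x)\<^sup>2\<close>, \<open>\<theta>\<^sub>4(2x) \<theta>\<^sub>4(0)\<close> and \<open>\<theta>\<^sub>1(2x) \<theta>\<^sub>1'(0)\<close> are quadratic expressions in \<open>A, B\<close>, their
  derivatives at \<open>x\<close>, and their values at \<open>0\<close>.  The claim is the polynomial identity between these
  expressions.
\<close>

theorem theta4_log_derivative_duplication:
  assumes "Im \<tau> > 0"
  defines "D \<equiv> \<lambda>\<epsilon> \<epsilon>' z. deriv (\<lambda>\<zeta>. theta \<epsilon> \<epsilon>' \<zeta> \<tau>) z"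
  shows "(2 * D 0 1 x * theta 0 1 (2 * x) \<tau> - theta 0 1 x \<tau> * D 0 1 (2 * x)) *
           theta 0 1 x \<tau> * theta 0 1 0 \<tau> = D 1 1 0 * theta 1 1 (2 * x) \<tau> * theta 1 1 x \<tau> ^ 2"
proof -
  have \<tau>2: "Im (2 * \<tau>) > 0" using assms by simp
  have d: "((\<lambda>\<zeta>. theta \<epsilon> \<epsilon>' \<zeta> \<tau>) has_field_derivative D \<epsilon> \<epsilon>' \<zeta>) (at \<zeta>)" for \<epsilon> \<epsilon>' \<zeta>
    unfolding D_def by (rule theta_has_field_derivative[OF assms(1)])
  define A where "A = (\<lambda>z. theta 0 0 (2 * z) (2 * \<tau>))"
  define B where "B = (\<lambda>z. theta 1 0 (2 * z) (2 * \<tau>))"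
  define A' B' where "A' = deriv A x" and "B' = deriv B x"
  have dA: "(A has_field_derivative A') (at x)" and dB: "(B has_field_derivative B') (at x)"
  proof -
    have "(\<lambda>z. theta \<epsilon> \<epsilon>' (2 * z) (2 * \<tau>)) field_differentiable at x" for \<epsilon> \<epsilon>'
      unfolding field_differentiable_def
      by (rule exI) (rule derivative_eq_intros DERIV_chain2[OF theta_has_field_derivative[OF \<tau>2]] refl)+
    thus "(A has_field_derivative A') (at x)" "(B has_field_derivative B') (at x)"
      by (simp_all add: A_def B_def A'_def B'_def field_differentiable_derivI)
  qed
  have th4_sq: "theta 0 1 z \<tau> * theta 0 1 z \<tau> = A z * A 0 - B z * B 0" for z
    using theta4_theta4[OF assms(1), of z 0] by (simp add: A_def B_def)
  have th4_double: "theta 0 1 (2 * z) \<tau> * theta 0 1 0 \<tau> = A z * A z - B z * B z" for z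
    using theta4_theta4[OF assms(1), of z z] by (simp add: A_def B_def)
  have th1_sq: "theta 1 1 x \<tau> ^ 2 = A x * B 0 - B x * A 0"
    using theta1_theta1[OF assms(1), of x 0] by (simp add: A_def B_def power2_eq_square)
  have "((\<lambda>z. theta 0 1 z \<tau> * theta 0 1 z \<tau>) has_field_derivative 2 * D 0 1 x * theta 0 1 x \<tau>) (at x)"
    by (rule derivative_eq_intros d refl)+ simp
  moreover have "((\<lambda>z. A z * A 0 - B z * B 0) has_field_derivative A' * A 0 - B' * B 0) (at x)"
    by (rule derivative_eq_intros dA dB refl)+ simp
  ultimately have th4_sq': "2 * D 0 1 x * theta 0 1 x \<tau> = A' * A 0 - B' * B 0"
    unfolding th4_sq by (rule DERIV_unique)
  have "((\<lambda>z. theta 0 1 (2 * z) \<tau> * theta 0 1 0 \<tau>) has_field_derivative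
          2 * (D 0 1 (2 * x) * theta 0 1 0 \<tau>)) (at x)"
    by (rule derivative_eq_intros DERIV_chain2[OF d] refl)+ simp
  moreover have "((\<lambda>z. A z * A z - B z * B z) has_field_derivative 2 * (A x * A' - B x * B')) (at x)"
    by (rule derivative_eq_intros dA dB refl)+ (simp add: algebra_simps)
  ultimately have "2 * (D 0 1 (2 * x) * theta 0 1 0 \<tau>) = 2 * (A x * A' - B x * B')"
    unfolding th4_double by (rule DERIV_unique)
  hence th4_double': "D 0 1 (2 * x) * theta 0 1 0 \<tau> = A x * A' - B x * B'"
    by (simp del: right_diff_distrib_numeral)
  have "((\<lambda>y. theta 1 1 (x + y) \<tau> * theta 1 1 (x - y) \<tau>) has_field_derivative
          - (D 1 1 0 * theta 1 1 (2 * x) \<tau>)) (at x)"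
    using has_field_derivative_product_add_diff[OF d[of 1 1] d[of 1 1], where x = x and y = x] by (simp add: theta_1_1_0[OF assms(1)] mult.commute)
  moreover have "((\<lambda>y. A x * B y - B x * A y) has_field_derivative A x * B' - B x * A') (at x)"
    by (intro DERIV_diff DERIV_cmult dA dB)
  ultimately have "- (D 1 1 0 * theta 1 1 (2 * x) \<tau>) = A x * B' - B x * A'"
    unfolding theta1_theta1[OF assms(1)] A_def B_def by (rule DERIV_unique)
  hence "D 1 1 0 * theta 1 1 (2 * x) \<tau> = - (A x * B' - B x * A')"
    by (metis minus_minus)
  hence th1_double: "D 1 1 0 * theta 1 1 (2 * x) \<tau> = A' * B x - A x * B'"
    by (simp add: mult.commute)
  have "(2 * D 0 1 x * theta 0 1 (2 * x) \<tau> - theta 0 1 x \<tau> * D 0 1 (2 * x)) * theta 0 1 x \<tau> * theta 0 1 0 \<tau> =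
     (2 * D 0 1 x * theta 0 1 x \<tau>) * (theta 0 1 (2 * x) \<tau> * theta 0 1 0 \<tau>) -
     (theta 0 1 x \<tau> * theta 0 1 x \<tau>) * (D 0 1 (2 * x) * theta 0 1 0 \<tau>)"
    by (simp add: algebra_simps)
  also have "\<dots> = (A' * A 0 - B' * B 0) * (A x * A x - B x * B x) -
     (A x * A 0 - B x * B 0) * (A x * A' - B x * B')"
    by (simp only: th4_sq th4_double th4_sq' th4_double')
  also have "\<dots> = (A' * B x - A x * B') * (A x * B 0 - B x * A 0)"
    by (simp add: algebra_simps)
  also have "\<dots> = D 1 1 0 * theta 1 1 (2 * x) \<tau> * theta 1 1 x \<tau> ^ 2"
    by (simp only: th1_double th1_sq)
  finally show ?thesis .
qed

section \<open>Points of order three\<close>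

lemma theta_shift_third:
  assumes "Im \<tau> > 0"
    and "\<epsilon>\<^sub>1 = \<epsilon> - 2 / 3" and "\<epsilon>\<^sub>1' = \<epsilon>' - 2 / 3"
    and "u = 2 * of_real pi * \<i> * (\<tau> / 18 - \<zeta> / 3 + 1 / 9 - of_real \<epsilon>' / 6)"
  shows "theta \<epsilon>\<^sub>1 \<epsilon>\<^sub>1' \<zeta> \<tau> = exp u * theta \<epsilon> \<epsilon>' (\<zeta> + - (\<tau> + 1) / 3) \<tau>"
proof -
  have 1: "2 * of_real pi * \<i> *
      (of_real (- 2 / 3) ^ 2 * \<tau> / 8 + of_real (- 2 / 3) / 2 * (\<zeta> + (of_real \<epsilon>' + of_real (- 2 / 3)) / 2)) = u"
    unfolding assms(4) by (simp add: field_simps power2_eq_square)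
  have 2: "\<zeta> + of_real (- 2 / 3) * \<tau> / 2 + of_real (- 2 / 3) / 2 = \<zeta> + - (\<tau> + 1) / 3"
    by (simp add: field_simps)
  have 3: "\<epsilon>\<^sub>1 = \<epsilon> + - 2 / 3" "\<epsilon>\<^sub>1' = \<epsilon>' + - 2 / 3"
    using assms(2,3) by simp_all
  show ?thesis
    using theta_shift[OF assms(1), of \<epsilon> "- 2 / 3" \<epsilon>' "- 2 / 3" \<zeta>] unfolding 1 2 3 .
qed

text \<open>
  Since \<open>2 p = -p - (\<tau> + 1)\<close>, the values of \<open>\<theta>\<^sub>1\<close> and \<open>\<theta>\<^sub>4\<close> at \<open>2 p\<close> are their values at \<open>p\<close> divided by a
  common factor, and \<open>\<theta>\<^sub>4'/\<theta>\<^sub>4(2p) = 2\<pi>\<i> - \<theta>\<^sub>4'/\<theta>\<^sub>4(p)\<close>.  Inserting this into the duplication formula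
  leaves only values at \<open>p\<close>.
\<close>

lemma theta_3_torsion:
  fixes \<tau> :: complex
  assumes "Im \<tau> > 0"
  defines "p \<equiv> - (\<tau> + 1) / 3"
  defines "D \<equiv> \<lambda>\<epsilon> \<epsilon>' z. deriv (\<lambda>\<zeta>. theta \<epsilon> \<epsilon>' \<zeta> \<tau>) z"
  shows "(3 * D 0 1 p - 2 * of_real pi * \<i> * theta 0 1 p \<tau>) * theta 0 1 p \<tau> ^ 2 * theta 0 1 0 \<tau> =
         D 1 1 0 * theta 1 1 p \<tau> ^ 3"
proof -
  have d: "((\<lambda>\<zeta>. theta \<epsilon> \<epsilon>' \<zeta> \<tau>) has_field_derivative D \<epsilon> \<epsilon>' \<zeta>) (at \<zeta>)" for \<epsilon> \<epsilon>' \<zeta>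
    unfolding D_def by (rule theta_has_field_derivative[OF assms(1)])
  define E where "E = (\<lambda>\<zeta>. exp (2 * of_real pi * \<i> * (\<tau> / 2 + 1 / 2 - \<zeta>)))"
  define e where "e = E (- p)"
  have e: "e \<noteq> 0" by (simp add: e_def E_def)
  have p: "- p - \<tau> - 1 = 2 * p" by (simp add: p_def field_simps)
  have shift4: "theta 0 1 (- \<zeta>) \<tau> = E \<zeta> * theta 0 1 (\<zeta> - \<tau> - 1) \<tau>" for \<zeta>
    using theta_shift[OF assms(1), of 0 "-2" 1 "-2" \<zeta>] theta_add_2_left[OF assms(1), of "-2" "-1" \<zeta>]
      theta_uminus[OF assms(1), of 0 "-1" \<zeta>]
    by (simp add: E_def algebra_simps)
  have shift1: "theta 1 1 (- \<zeta>) \<tau> = E \<zeta> * theta 1 1 (\<zeta> - \<tau> - 1) \<tau>" for \<zeta>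
    using theta_shift[OF assms(1), of 1 "-2" 1 "-2" \<zeta>] theta_uminus[OF assms(1), of "-1" "-1" \<zeta>]
    by (simp add: E_def algebra_simps)
  have th4: "theta 0 1 p \<tau> = e * theta 0 1 (2 * p) \<tau>"
    and th1: "theta 1 1 p \<tau> = e * theta 1 1 (2 * p) \<tau>"
    using shift4[of "- p"] shift1[of "- p"] by (simp_all add: p e_def)
  have "((\<lambda>\<zeta>. theta 0 1 (- \<zeta>) \<tau>) has_field_derivative - D 0 1 p) (at (- p))"
  proof -
    have "((\<lambda>\<zeta>. theta 0 1 (- \<zeta>) \<tau>) has_field_derivative D 0 1 (- (- p)) * (- 1)) (at (- p))"
      by (rule DERIV_chain2[OF d]) (auto intro!: derivative_eq_intros)
    thus ?thesis by simp
  qed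
  moreover have "((\<lambda>\<zeta>. E \<zeta> * theta 0 1 (\<zeta> - \<tau> - 1) \<tau>) has_field_derivative
      e * (D 0 1 (2 * p) - 2 * of_real pi * \<i> * theta 0 1 (2 * p) \<tau>)) (at (- p))"
    unfolding E_def
    by (rule derivative_eq_intros DERIV_chain2[OF d] refl)+ (simp only: p e_def E_def, simp add: algebra_simps)
  ultimately have "- D 0 1 p = e * (D 0 1 (2 * p) - 2 * of_real pi * \<i> * theta 0 1 (2 * p) \<tau>)"
    unfolding shift4 by (rule DERIV_unique)
  hence D4: "D 0 1 p = e * (2 * of_real pi * \<i> * theta 0 1 (2 * p) \<tau> - D 0 1 (2 * p))"
    by (simp add: algebra_simps)
  have "(2 * D 0 1 p * theta 0 1 (2 * p) \<tau> - theta 0 1 p \<tau> * D 0 1 (2 * p)) *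
           theta 0 1 p \<tau> * theta 0 1 0 \<tau> = D 1 1 0 * theta 1 1 (2 * p) \<tau> * theta 1 1 p \<tau> ^ 2"
    unfolding D_def by (rule theta4_log_derivative_duplication[OF assms(1)])
  hence A: "(2 * D 0 1 p * (e * theta 0 1 (2 * p) \<tau>) - theta 0 1 p \<tau> * (e * D 0 1 (2 * p))) *
           theta 0 1 p \<tau> * theta 0 1 0 \<tau> = D 1 1 0 * (e * theta 1 1 (2 * p) \<tau>) * theta 1 1 p \<tau> ^ 2"
    by algebra
  have eD: "e * D 0 1 (2 * p) = 2 * of_real pi * \<i> * theta 0 1 p \<tau> - D 0 1 p"
    unfolding D4 th4 by (simp add: algebra_simps)
  show ?thesis
    using A unfolding th4[symmetric] th1[symmetric] eD by (simp add: algebra_simps power2_eq_square power3_eq_cube)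
qed

theorem theorem6p1:
  fixes \<tau> :: complex
  assumes "Im \<tau> > 0"
  shows
    "theta_deriv (1/3) (1/3) \<tau> / theta_const (1/3) (1/3) \<tau>
       = 1 / 3 * (theta_deriv 1 1 \<tau> * theta_const (1/3) (1/3) \<tau> ^ 3
                  / (theta_const 0 1 \<tau> * theta_const (2/3) (5/3) \<tau> ^ 3))
         - root_zeta 3 *
             (theta_deriv 1 1 \<tau> * theta_const 0 1 \<tau> * theta_const (1/3) (4/3) \<tau>
                * theta_const (2/3) (2/3) \<tau>
              / (theta_const 0 0 \<tau> * theta_const 1 0 \<tau> * theta_const (1/3) (1/3) \<tau>
                * theta_const (2/3) (5/3) \<tau>))
     \<and> 1 / 3 * (theta_deriv 1 1 \<tau> * theta_const (1/3) (1/3) \<tau> ^ 3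
                  / (theta_const 0 1 \<tau> * theta_const (2/3) (5/3) \<tau> ^ 3))
         - root_zeta 3 *
             (theta_deriv 1 1 \<tau> * theta_const 0 1 \<tau> * theta_const (1/3) (4/3) \<tau>
                * theta_const (2/3) (2/3) \<tau>
              / (theta_const 0 0 \<tau> * theta_const 1 0 \<tau> * theta_const (1/3) (1/3) \<tau>
                * theta_const (2/3) (5/3) \<tau>))
       = - (of_real pi / 3) * theta_const 0 0 \<tau> * theta_const 1 0 \<tau>
             * (theta_const (1/3) (1/3) \<tau> ^ 3 / theta_const (2/3) (5/3) \<tau> ^ 3)
         + of_real pi * root_zeta 3 * theta_const 0 1 \<tau> ^ 2
             * (theta_const (1/3) (4/3) \<tau> * theta_const (2/3) (2/3) \<tau>
                / (theta_const (1/3) (1/3) \<tau> * theta_const (2/3) (5/3) \<tau>))"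
proof (intro conjI)
  define p where "p = - (\<tau> + 1) / 3"
  define D where "D = (\<lambda>\<epsilon> \<epsilon>' z. deriv (\<lambda>\<zeta>. theta \<epsilon> \<epsilon>' \<zeta> \<tau>) z)"
  have d: "((\<lambda>\<zeta>. theta \<epsilon> \<epsilon>' \<zeta> \<tau>) has_field_derivative D \<epsilon> \<epsilon>' \<zeta>) (at \<zeta>)" for \<epsilon> \<epsilon>' \<zeta>
    unfolding D_def by (rule theta_has_field_derivative[OF assms])
  define c where "c = exp (2 * of_real pi * \<i> * (\<tau> / 18 - 1 / 18))"
  define z3 where "z3 = root_zeta 3"
  have c0: "c \<noteq> 0" by (simp add: c_def)
  have z3: "z3 ^ 3 = 1"
  proof -
    have "exp (2 * (\<i> * of_real pi)) = 1"
      using exp_two_pi_i by (simp only: mult_ac)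
    thus ?thesis
      unfolding z3_def root_zeta_def by (simp flip: exp_of_nat_mult)
  qed
  hence z30: "z3 \<noteq> 0" by auto

  define k where "k = 2 * of_real pi * \<i> / 3"
  have shift11: "theta (1/3) (1/3) \<zeta> \<tau> = c * exp (- (k * \<zeta>)) * theta 1 1 (\<zeta> + p) \<tau>" for \<zeta>
    unfolding c_def k_def mult_exp_exp p_def
    by (rule theta_shift_third[OF assms]) (simp_all add: field_simps)
  have t11: "theta_const (1/3) (1/3) \<tau> = c * theta 1 1 p \<tau>"
    using shift11[of 0] by (simp add: theta_const_def)
  \<comment> \<open>The characteristic \<open>[2/3,-1/3]\<close> is reached from \<open>[0,1]\<close> by a reflection; raising \<open>-1/3\<close> to \<open>5/3\<close>
    costs the factor \<open>exp(2\<pi>\<i>/3)\<close>.\<close>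
  have t25: "theta_const (2/3) (5/3) \<tau> = z3 * c * theta 0 1 p \<tau>"
  proof -
    have "theta_const (2/3) (5/3) \<tau> = z3 * theta (2/3) (-1/3) 0 \<tau>"
      using theta_add_2_right[OF assms, of "2/3" "-1/3" 0]
      by (simp add: theta_const_def z3_def root_zeta_def mult_ac)
    also have "theta (2/3) (-1/3) 0 \<tau> = c * theta 0 1 p \<tau>"
    proof -
      have "theta (2/3) (-1/3) 0 \<tau> = theta (-2/3) (1/3) 0 \<tau>"
        using theta_uminus[OF assms, of "2/3" "-1/3" 0] by simp
      also have "\<dots> = c * theta 0 1 (0 + p) \<tau>"
        unfolding c_def p_def by (rule theta_shift_third[OF assms]) (simp_all add: field_simps)
      finally show ?thesis by simp
    qed
    finally show ?thesis by simp
  qed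
  \<comment> \<open>Here the shift starts from \<open>[1,2]\<close>, which is \<open>-\<theta>\<^sub>2\<close>.\<close>
  have t43: "theta_const (1/3) (4/3) \<tau> = - exp (2 * of_real pi * \<i> * (\<tau> / 18 - 2 / 9)) * theta 1 0 p \<tau>"
  proof -
    have "theta (1/3) (4/3) 0 \<tau> = exp (2 * of_real pi * \<i> * (\<tau> / 18 - 2 / 9)) * theta 1 2 (0 + p) \<tau>"
      unfolding p_def by (rule theta_shift_third[OF assms]) (simp_all add: field_simps)
    thus ?thesis
      using theta_add_2_right[OF assms, of 1 0 p] by (simp add: theta_const_def)
  qed
  have t22: "theta_const (2/3) (2/3) \<tau> = exp (2 * of_real pi * \<i> * (\<tau> / 18 + 1 / 9)) * theta 0 0 p \<tau>"
  proof -
    have "theta (2/3) (2/3) 0 \<tau> = theta (-2/3) (-2/3) 0 \<tau>"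
      using theta_uminus[OF assms, of "2/3" "2/3" 0] by simp
    also have "\<dots> = exp (2 * of_real pi * \<i> * (\<tau> / 18 + 1 / 9)) * theta 0 0 (0 + p) \<tau>"
      unfolding p_def by (rule theta_shift_third[OF assms]) (simp_all add: field_simps)
    finally show ?thesis by (simp add: theta_const_def)
  qed
  have t43_t22: "theta_const (1/3) (4/3) \<tau> * theta_const (2/3) (2/3) \<tau> = - (c ^ 2) * (theta 1 0 p \<tau> * theta 0 0 p \<tau>)"
  proof -
    have "exp (2 * of_real pi * \<i> * (\<tau> / 18 - 2 / 9)) * exp (2 * of_real pi * \<i> * (\<tau> / 18 + 1 / 9)) = c ^ 2"
      unfolding c_def power2_eq_square mult_exp_exp
      by (intro arg_cong[of _ _ exp]) (simp add: field_simps)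
    thus ?thesis unfolding t43 t22 by simp
  qed

  define a1 a4 a1' a4' b where "a1 = theta 1 1 p \<tau>" and "a4 = theta 0 1 p \<tau>"
    and "a1' = D 1 1 p" and "a4' = D 0 1 p" and "b = theta 1 0 p \<tau> * theta 0 0 p \<tau>"
  define T1' T2 T3 T4 where "T1' = theta_deriv 1 1 \<tau>" and "T2 = theta_const 1 0 \<tau>"
    and "T3 = theta_const 0 0 \<tau>" and "T4 = theta_const 0 1 \<tau>"
  have nz: "a1 \<noteq> 0" "a4 \<noteq> 0" "T2 \<noteq> 0" "T3 \<noteq> 0" "T4 \<noteq> 0"
    using theta_const_nonzero[OF assms, of "1/3" "1/3"] theta_const_nonzero[OF assms, of "2/3" "5/3"]
      theta_const_nonzero[OF assms, of 0] theta_const_1_0_nonzero[OF assms]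
    by (auto simp: t11 t25 a1_def a4_def T2_def T3_def T4_def)

  have log_deriv: "theta_deriv (1/3) (1/3) \<tau> / theta_const (1/3) (1/3) \<tau> = a1' / a1 - 2 * of_real pi * \<i> / 3"
  proof -
    have "((\<lambda>\<zeta>. c * exp (- (k * \<zeta>)) * theta 1 1 (\<zeta> + p) \<tau>) has_field_derivative
        c * (a1' - k * a1)) (at 0)"
      by (rule derivative_eq_intros DERIV_chain2[OF d] refl)+ (simp add: a1_def a1'_def algebra_simps)
    hence "theta_deriv (1/3) (1/3) \<tau> = c * (a1' - k * a1)"
      unfolding theta_deriv_def shift11[abs_def] by (rule DERIV_imp_deriv)
    thus ?thesis using c0 nz by (simp add: t11 a1_def[symmetric] k_def field_simps)
  qed
  have wronskian: "(a1' * a4 - a1 * a4') * (T2 * T3) = T1' * T4 * b"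
    using theta1_theta4_wronskian[OF assms, of p]
    by (simp add: a1_def a4_def a1'_def a4'_def b_def T1'_def T2_def T3_def T4_def D_def
        theta_const_def theta_deriv_def)
  have torsion: "(3 * a4' - 2 * of_real pi * \<i> * a4) * a4 ^ 2 * T4 = T1' * a1 ^ 3"
    using theta_3_torsion[OF assms]
    by (simp add: a1_def a4_def a1'_def a4'_def T1'_def T4_def D_def p_def
        theta_const_def theta_deriv_def)
  have jacobi: "T1' = - of_real pi * T3 * T2 * T4"
    unfolding T1'_def T2_def T3_def T4_def by (rule theta_deriv_1_1_eq[OF assms])

  have cube: "theta_const (1/3) (1/3) \<tau> ^ 3 / theta_const (2/3) (5/3) \<tau> ^ 3 = a1 ^ 3 / a4 ^ 3"
    using c0 z3 by (simp add: t11 t25 a1_def a4_def power_mult_distrib)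
  have quot: "z3 * (theta_const (1/3) (4/3) \<tau> * theta_const (2/3) (2/3) \<tau> /
     (theta_const (1/3) (1/3) \<tau> * theta_const (2/3) (5/3) \<tau>)) = - b / (a1 * a4)"
    using c0 z30 unfolding t43_t22 t11 t25 b_def[symmetric] a1_def[symmetric] a4_def[symmetric]
    by (simp add: power2_eq_square)
  have term1: "1 / 3 * (theta_deriv 1 1 \<tau> * theta_const (1/3) (1/3) \<tau> ^ 3
                  / (theta_const 0 1 \<tau> * theta_const (2/3) (5/3) \<tau> ^ 3)) =
               1 / 3 * (T1' / T4) * (a1 ^ 3 / a4 ^ 3)"
    unfolding cube[symmetric] T1'_def T4_def by simp
  have term2: "root_zeta 3 * (theta_deriv 1 1 \<tau> * theta_const 0 1 \<tau> * theta_const (1/3) (4/3) \<tau>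
                * theta_const (2/3) (2/3) \<tau>
              / (theta_const 0 0 \<tau> * theta_const 1 0 \<tau> * theta_const (1/3) (1/3) \<tau>
                * theta_const (2/3) (5/3) \<tau>)) = - (T1' * T4 / (T3 * T2)) * (b / (a1 * a4))"
  proof -
    have "- (T1' * T4 / (T3 * T2)) * (b / (a1 * a4)) = (T1' * T4 / (T3 * T2)) * (- b / (a1 * a4))"
      by simp
    also have "\<dots> = T1' * T4 / (T3 * T2) * (z3 * (theta_const (1/3) (4/3) \<tau> * theta_const (2/3) (2/3) \<tau> /
     (theta_const (1/3) (1/3) \<tau> * theta_const (2/3) (5/3) \<tau>)))"
      by (simp only: quot)
    finally show ?thesis by (simp add: T1'_def T2_def T3_def T4_def z3_def mult_ac)
  qed

  have Z14: "a1' / a1 = a4' / a4 + T1' * T4 / (T3 * T2) * (b / (a1 * a4))"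
  proof -
    have "a1' / a1 - a4' / a4 = (a1' * a4 - a1 * a4') * (T2 * T3) / (T3 * T2 * (a1 * a4))"
      using nz by (simp add: field_simps)
    also have "\<dots> = T1' * T4 / (T3 * T2) * (b / (a1 * a4))"
      unfolding wronskian by simp
    finally show ?thesis by (simp add: algebra_simps)
  qed
  have Z4: "a4' / a4 = 2 * of_real pi * \<i> / 3 + 1 / 3 * (T1' / T4) * (a1 ^ 3 / a4 ^ 3)"
  proof -
    have "3 * (a4' / a4) - 2 * of_real pi * \<i> = (3 * a4' - 2 * of_real pi * \<i> * a4) * a4 ^ 2 * T4 / (T4 * a4 ^ 3)"
      using nz by (simp add: field_simps power2_eq_square power3_eq_cube)
    also have "\<dots> = T1' / T4 * (a1 ^ 3 / a4 ^ 3)"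
      unfolding torsion by simp
    finally show ?thesis by (simp add: field_simps)
  qed
  show "theta_deriv (1/3) (1/3) \<tau> / theta_const (1/3) (1/3) \<tau>
       = 1 / 3 * (theta_deriv 1 1 \<tau> * theta_const (1/3) (1/3) \<tau> ^ 3
                  / (theta_const 0 1 \<tau> * theta_const (2/3) (5/3) \<tau> ^ 3))
         - root_zeta 3 *
             (theta_deriv 1 1 \<tau> * theta_const 0 1 \<tau> * theta_const (1/3) (4/3) \<tau>
                * theta_const (2/3) (2/3) \<tau>
              / (theta_const 0 0 \<tau> * theta_const 1 0 \<tau> * theta_const (1/3) (1/3) \<tau>
                * theta_const (2/3) (5/3) \<tau>))"
    unfolding log_deriv term1 term2 Z14 Z4 by simp

  have e1: "1 / 3 * (T1' / T4) * (a1 ^ 3 / a4 ^ 3) = - (of_real pi / 3) * T3 * T2 * (a1 ^ 3 / a4 ^ 3)"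
    using nz by (simp add: jacobi)
  have e2: "- (T1' * T4 / (T3 * T2)) * (b / (a1 * a4)) = of_real pi * T4 ^ 2 * (b / (a1 * a4))"
    using nz by (simp add: jacobi power2_eq_square)
  have e3: "of_real pi * root_zeta 3 * theta_const 0 1 \<tau> ^ 2
             * (theta_const (1/3) (4/3) \<tau> * theta_const (2/3) (2/3) \<tau>
                / (theta_const (1/3) (1/3) \<tau> * theta_const (2/3) (5/3) \<tau>))
             = - (of_real pi * T4 ^ 2 * (b / (a1 * a4)))"
  proof -
    have "of_real pi * z3 * T4 ^ 2 * u = of_real pi * T4 ^ 2 * (z3 * u)" for u
      by simp
    thus ?thesis
      unfolding z3_def[symmetric] T4_def[symmetric] by (simp only: quot) simp
  qed
  show "1 / 3 * (theta_deriv 1 1 \<tau> * theta_const (1/3) (1/3) \<tau> ^ 3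
                  / (theta_const 0 1 \<tau> * theta_const (2/3) (5/3) \<tau> ^ 3))
         - root_zeta 3 *
             (theta_deriv 1 1 \<tau> * theta_const 0 1 \<tau> * theta_const (1/3) (4/3) \<tau>
                * theta_const (2/3) (2/3) \<tau>
              / (theta_const 0 0 \<tau> * theta_const 1 0 \<tau> * theta_const (1/3) (1/3) \<tau>
                * theta_const (2/3) (5/3) \<tau>))
       = - (of_real pi / 3) * theta_const 0 0 \<tau> * theta_const 1 0 \<tau>
             * (theta_const (1/3) (1/3) \<tau> ^ 3 / theta_const (2/3) (5/3) \<tau> ^ 3)
         + of_real pi * root_zeta 3 * theta_const 0 1 \<tau> ^ 2
             * (theta_const (1/3) (4/3) \<tau> * theta_const (2/3) (2/3) \<tau>
                / (theta_const (1/3) (1/3) \<tau> * theta_const (2/3) (5/3) \<tau>))"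
    unfolding term1 term2 cube e3 unfolding e1 e2 unfolding T2_def T3_def by simp
qed

end
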